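(* There is a constant $C>1$ such that for all integers $1\le m\le N$, $$c_m\,N^{\frac1{2m}}\binom{N}{m}^{-\frac{1}{2m}}\ \le\ \rho(\mathcal{B}^N_{=m})\ \le\ C_m\,N^{\frac1{2m}}\binom{N}{m}^{-\frac1{2m}},$$ where $$c_m=\frac{1}{m^{\frac{1}{2m}}\,C^{\sqrt{\frac{\log m}{m}}}}\qquad\text{and}\qquad C_m=C^{\frac1m}.$$
   Context: Here $[N]=\{1,\dots,N\}$ and $\{\pm1\}^N$ carries the normalized counting measure, $\mathbb{E}[f]=2^{-N}\sum_{x\in\{\pm1\}^N}f(x)$. Every $f\colon\{\pm1\}^N\to\mathbb{R}$ has the Fourier-Walsh expansion $f(x)=\sum_{S\subset[N]}\widehat f(S)x^S$, where $x^S=\prod_{k\in S}x_k$ (with $x^\emptyset=1$) and $\widehat f(S)=\mathbb{E}[f(x)\,x^S]$. Put $\|f\|_\infty=\max_{x}|f(x)|$. For a class $\mathcal{F}$ of functions on $\{\pm1\}^N$, its Boolean radius is $$\rho(\mathcal{F})=\sup\Big\{\rho\ge 0:\ \sum_{S\subset[N]}|\widehat f(S)|\rho^{|S|}\le\|f\|_\infty\ \text{for every } f\in\mathcal{F}\Big\}.$$ $f$ is called $m$-homogeneous if $\widehat f(S)=0$ for all $S\subset[N]$ with $|S|\ne m$; $\mathcal{B}^N_{=m}$ denotes the class of all $m$-homogeneous functions $f\colon\{\pm1\}^N\to\mathbb{R}$. $\log$ is the natural logarithm. *)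

theory Defs
  imports Complex_Main "HOL-Library.FuncSet" "HOL-Library.Extended_Real"
begin

text \<open>
  The points of the cube are extensional maps on \<open>{1..N}\<close>, so that the cube is a finite set
  with exactly \<open>2 ^ N\<close> elements. A function on the cube is represented by a total function
  on \<open>nat \<Rightarrow> real\<close>; all notions below depend only on its values on the cube.
\<close>

definition cube :: "nat \<Rightarrow> (nat \<Rightarrow> real) set" where
  "cube N = {1..N} \<rightarrow>\<^sub>E {-1, 1}"

definition cube_expectation :: "nat \<Rightarrow> ((nat \<Rightarrow> real) \<Rightarrow> real) \<Rightarrow> real" where
  "cube_expectation N f = (\<Sum>x\<in>cube N. f x) / 2 ^ N"

definition walsh :: "nat set \<Rightarrow> (nat \<Rightarrow> real) \<Rightarrow> real" where
  "walsh S x = (\<Prod>k\<in>S. x k)"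

definition fourier_coeff :: "nat \<Rightarrow> ((nat \<Rightarrow> real) \<Rightarrow> real) \<Rightarrow> nat set \<Rightarrow> real" where
  "fourier_coeff N f S = cube_expectation N (\<lambda>x. f x * walsh S x)"

definition cube_sup_norm :: "nat \<Rightarrow> ((nat \<Rightarrow> real) \<Rightarrow> real) \<Rightarrow> real" where
  "cube_sup_norm N f = Max ((\<lambda>x. \<bar>f x\<bar>) ` cube N)"

text \<open>
  The supremum is taken in the extended reals because it is infinite for some classes,
  for instance when every function in the class is constant.
\<close>

definition boolean_radius :: "nat \<Rightarrow> ((nat \<Rightarrow> real) \<Rightarrow> real) set \<Rightarrow> ereal" where
  "boolean_radius N F =
    (SUP \<rho>\<in>{\<rho>::real. \<rho> \<ge> 0 \<and>
        (\<forall>f\<in>F. (\<Sum>S\<in>Pow {1..N}. \<bar>fourier_coeff N f S\<bar> * \<rho> ^ card S) \<le> cube_sup_norm N f)}.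
      ereal \<rho>)"

definition homogeneous :: "nat \<Rightarrow> nat \<Rightarrow> ((nat \<Rightarrow> real) \<Rightarrow> real) \<Rightarrow> bool" where
  "homogeneous N m f \<longleftrightarrow> (\<forall>S. S \<subseteq> {1..N} \<and> card S \<noteq> m \<longrightarrow> fourier_coeff N f S = 0)"

definition homogeneous_class :: "nat \<Rightarrow> nat \<Rightarrow> ((nat \<Rightarrow> real) \<Rightarrow> real) set" where
  "homogeneous_class N m = {f. homogeneous N m f}"

end

theory Submission
  imports Defs "HOL-Analysis.Convex" "HOL-Computational_Algebra.Polynomial"
begin

text \<open>
  For an \<open>m\<close>-homogeneous function \<open>f\<close> with Walsh coefficients \<open>a S\<close> and maximum \<open>B\<close>, the inequality
  that defines the Boolean radius is \<open>\<rho> ^ m * (\<Sum>S. \<bar>a S\<bar>) \<le> B\<close>. So the radius is determined by how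
  large \<open>(\<Sum>S. \<bar>a S\<bar>) / B\<close> can be, and the claim is that this is \<open>sqrt ((N choose m) / N)\<close>, up to
  a constant factor from below and up to \<open>exp (c * sqrt (m * ln m))\<close> from above.

  Large ratios come from random signs: if all coefficients are \<open>1\<close> or \<open>-1\<close>, a union bound over the
  \<open>2 ^ N\<close> points of the cube gives a choice of signs with maximum at most
  \<open>3 * sqrt (N * (N choose m))\<close> (\<open>exists_flat_homogeneous\<close>). This bounds the radius from above.

  The bound of the radius from below is a Bohnenblust-Hille argument at an intermediate level
  \<open>k \<le> m\<close> (\<open>sum_abs_coeff_le_level\<close>). By double counting and Cauchy-Schwarz, the sum of the \<open>\<bar>a S\<bar>\<close>
  is controlled by the sum of the \<open>L\<^sup>2\<close>-norms of the discrete derivatives \<open>D\<^sub>T f\<close> over all sets \<open>T\<close> of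
  size \<open>k\<close>. Three ingredients bound the latter.
  First, \<open>D\<^sub>T f\<close> has degree at most \<open>m\<close>, so its \<open>L\<^sup>2\<close>-norm is at most \<open>3 powr (m / k)\<close> times its
  \<open>L\<^sup>p\<close>-norm with \<open>p = 2 * k / (k + 1)\<close> (\<open>l2_norm_le_lp_norm\<close>); this follows from Bonami's fourth
  moment inequality by interpolation.
  Second, for a fixed point \<open>x\<close> the numbers \<open>D\<^sub>T f x\<close> are the coefficients of a \<open>k\<close>-homogeneous
  function, the degree \<open>k\<close> part of the Taylor expansion of \<open>f\<close> at \<open>x\<close>. Restricting \<open>f\<close> to lines and
  estimating the coefficients of a bounded real polynomial through its Chebyshev expansion shows
  that this function is bounded by \<open>B\<close> times a power of \<open>m\<close> with exponent of the order of \<open>k\<close>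
  (\<open>polarization_bound\<close>).
  Third, the \<open>l\<^sup>p\<close>-norm of the coefficients of a \<open>k\<close>-homogeneous function is at most a constant,
  exponential in \<open>k\<close> up to polynomial factors, times its maximum (\<open>mixed_norm_le_sup_norm\<close> and
  \<open>sum_powr_le_of_mixed_norm_le\<close>). This constant may be crude because \<open>k\<close> is small.
  Passing from the \<open>l\<^sup>p\<close>-norm over the sets \<open>T\<close> to their sum costs
  \<open>(N choose k) powr (1 / 2 - 1 / (2 * k))\<close>; the deviation of this exponent from \<open>1 / 2\<close> is what yields
  the gain of \<open>1 / sqrt N\<close>. The total cost is
  \<open>exp (O (m / k + k * ln m))\<close>, and \<open>k\<close> close to \<open>sqrt (m / ln m)\<close> makes it
  \<open>exp (O (sqrt (m * ln m)))\<close>, which the \<open>m\<close>-th power of the constant in the claim absorbs.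
\<close>

section \<open>Walsh analysis on finite cubes\<close>

text \<open>
  The index set is arbitrary because two cubes occur: the one on which functions live, with
  coordinates as indices, and the one of random choices of signs, indexed by sets of coordinates.
\<close>

definition sign_cube :: "'i set \<Rightarrow> ('i \<Rightarrow> real) set" where
  "sign_cube I = I \<rightarrow>\<^sub>E {-1, 1}"

definition mean :: "'i set \<Rightarrow> (('i \<Rightarrow> real) \<Rightarrow> real) \<Rightarrow> real" where
  "mean I f = (\<Sum>x\<in>sign_cube I. f x) / 2 ^ card I"

definition walsh_sum :: "nat set \<Rightarrow> (nat set \<Rightarrow> real) \<Rightarrow> (nat \<Rightarrow> real) \<Rightarrow> real" where
  "walsh_sum I a x = (\<Sum>S\<in>Pow I. a S * walsh S x)"

lemma finite_sign_cube [simp]: "finite I \<Longrightarrow> finite (sign_cube I)"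
  by (simp add: sign_cube_def finite_PiE)

lemma card_sign_cube: "finite I \<Longrightarrow> card (sign_cube I) = 2 ^ card I"
  by (simp add: sign_cube_def card_PiE numeral_2_eq_2)

lemma sign_cube_nonempty: "sign_cube I \<noteq> {}"
  by (simp add: sign_cube_def PiE_eq_empty_iff)

lemma sign_cube_values: "x \<in> sign_cube I \<Longrightarrow> i \<in> I \<Longrightarrow> x i = 1 \<or> x i = -1"
  by (auto simp: sign_cube_def PiE_def Pi_def)

lemma sum_sign_cube_insert:
  assumes "i \<notin> I"
  shows "(\<Sum>x\<in>sign_cube (insert i I). f x)
       = (\<Sum>x\<in>sign_cube I. f (x(i := 1))) + (\<Sum>x\<in>sign_cube I. f (x(i := -1)) :: real)"
proof -
  have "sign_cube (insert i I) = (\<lambda>(c, x). x(i := c)) ` ({-1, 1} \<times> sign_cube I)"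
    by (simp add: sign_cube_def PiE_insert_eq)
  moreover have "inj_on (\<lambda>(c, x). x(i := c)) ({-1, 1::real} \<times> sign_cube I)"
  proof (rule inj_onI)
    fix p q :: "real \<times> ('a \<Rightarrow> real)"
    assume p: "p \<in> {-1, 1} \<times> sign_cube I" and q: "q \<in> {-1, 1} \<times> sign_cube I"
      and eq: "(case p of (c, x) \<Rightarrow> x(i := c)) = (case q of (c, x) \<Rightarrow> x(i := c))"
    obtain c x c' y where pq: "p = (c, x)" "q = (c', y)" by fastforce
    have u: "x(i := c) = y(i := c')" using eq pq by simp
    have "x i = undefined" "y i = undefined"
      using p q pq assms by (auto simp: sign_cube_def PiE_def extensional_def)
    then show "p = q" using u pq by (metis fun_upd_same fun_upd_triv fun_upd_upd)
  qed
  ultimately have "(\<Sum>x\<in>sign_cube (insert i I). f x)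
      = (\<Sum>(c, x)\<in>{-1, 1} \<times> sign_cube I. f (x(i := c)))"
    by (simp add: sum.reindex case_prod_unfold)
  also have "\<dots> = (\<Sum>c\<in>{-1, 1::real}. \<Sum>x\<in>sign_cube I. f (x(i := c)))"
    by (simp add: sum.cartesian_product)
  finally show ?thesis by simp
qed

lemma mean_insert:
  assumes "finite I" "i \<notin> I"
  shows "mean (insert i I) f
       = (mean I (\<lambda>x. f (x(i := 1))) + mean I (\<lambda>x. f (x(i := -1)))) / 2"
  using assms by (simp add: mean_def sum_sign_cube_insert add_divide_distrib)

lemma mean_mono: "(\<And>x. x \<in> sign_cube I \<Longrightarrow> f x \<le> g x) \<Longrightarrow> mean I f \<le> mean I g"
  by (simp add: mean_def divide_right_mono sum_mono)

lemma mean_nonneg: "(\<And>x. x \<in> sign_cube I \<Longrightarrow> 0 \<le> f x) \<Longrightarrow> 0 \<le> mean I f"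
  by (simp add: mean_def sum_nonneg)

lemma mean_add: "mean I (\<lambda>x. f x + g x) = mean I f + mean I g"
  by (simp add: mean_def sum.distrib add_divide_distrib)

lemma mean_cmult: "mean I (\<lambda>x. c * f x) = c * mean I f"
  by (simp add: mean_def sum_distrib_left)

lemma mean_sum: "mean I (\<lambda>x. \<Sum>j\<in>J. f j x) = (\<Sum>j\<in>J. mean I (f j))"
  by (simp add: mean_def sum_divide_distrib sum.swap[of _ J])

lemma mean_const: "finite I \<Longrightarrow> mean I (\<lambda>x. c) = c"
  by (simp add: mean_def card_sign_cube)

lemma mean_le_const:
  "finite I \<Longrightarrow> (\<And>x. x \<in> sign_cube I \<Longrightarrow> f x \<le> c) \<Longrightarrow> mean I f \<le> c"
  using mean_mono[of I f "\<lambda>x. c"] by (simp add: mean_const)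

lemma mean_cong: "(\<And>x. x \<in> sign_cube I \<Longrightarrow> f x = g x) \<Longrightarrow> mean I f = mean I g"
  by (simp add: mean_def)

lemma walsh_fun_upd: "i \<notin> S \<Longrightarrow> walsh S (x(i := c)) = walsh S x"
  by (auto simp: walsh_def intro!: prod.cong)

lemma walsh_insert: "finite S \<Longrightarrow> i \<notin> S \<Longrightarrow> walsh (insert i S) x = x i * walsh S x"
  by (simp add: walsh_def)

lemma walsh_sum_fun_upd: "i \<notin> I \<Longrightarrow> walsh_sum I a (x(i := c)) = walsh_sum I a x"
  unfolding walsh_sum_def by (intro sum.cong refl) (metis PowD subsetD walsh_fun_upd)

lemma walsh_sum_insert:
  assumes "finite I" "i \<notin> I"
  shows "walsh_sum (insert i I) a x = walsh_sum I a x + x i * walsh_sum I (\<lambda>S. a (insert i S)) x"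
proof -
  have inj: "inj_on (insert i) (Pow I)"
    using assms by (auto simp: inj_on_def)
  have "walsh_sum (insert i I) a x
      = walsh_sum I a x + (\<Sum>S\<in>insert i ` Pow I. a S * walsh S x)"
    unfolding walsh_sum_def Pow_insert using assms
    by (subst sum.union_disjoint) auto
  also have "(\<Sum>S\<in>insert i ` Pow I. a S * walsh S x)
      = (\<Sum>S\<in>Pow I. x i * (a (insert i S) * walsh S x))"
    unfolding sum.reindex[OF inj] o_def using assms
    by (intro sum.cong refl) (metis PowD finite_subset mult.left_commute subsetD walsh_insert)
  finally show ?thesis by (simp add: walsh_sum_def sum_distrib_left)
qed

lemma mean_product:
  assumes "finite I"
  shows "mean I (\<lambda>x. \<Prod>i\<in>I. g i (x i)) = (\<Prod>i\<in>I. (g i 1 + g i (-1)) / 2)"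
proof -
  have "(\<Sum>x\<in>sign_cube I. \<Prod>i\<in>I. g i (x i)) = (\<Prod>i\<in>I. \<Sum>c\<in>{-1, 1}. g i c)"
    unfolding sign_cube_def using prod_sum_PiE[OF assms, of "\<lambda>_. {-1, 1}" g] by simp
  then show ?thesis
    by (simp add: mean_def prod_dividef add.commute)
qed

lemma mean_walsh_mult:
  assumes "finite I" "S \<subseteq> I" "T \<subseteq> I"
  shows "mean I (\<lambda>x. walsh S x * walsh T x) = (if S = T then 1 else 0)"
proof -
  have ext: "walsh U x = (\<Prod>i\<in>I. if i \<in> U then x i else 1)" if "U \<subseteq> I" for U x
    unfolding walsh_def using that assms(1)
    by (simp add: prod.If_cases Int_absorb1)
  define g where "g i c = (if i \<in> S then c else 1) * (if i \<in> T then c else (1::real))" for i c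
  have "mean I (\<lambda>x. walsh S x * walsh T x) = (\<Prod>i\<in>I. (g i 1 + g i (-1)) / 2)"
    using assms mean_product[OF assms(1), of g] by (simp add: ext prod.distrib g_def)
  also have "\<dots> = (\<Prod>i\<in>I. if i \<in> S \<longleftrightarrow> i \<in> T then 1 else 0)"
    by (intro prod.cong) (auto simp: g_def)
  also have "\<dots> = (if S = T then 1 else 0)"
    using assms by (auto intro!: prod_zero)
  finally show ?thesis .
qed

lemma mean_walsh_sum_mult_walsh:
  assumes "finite I" "T \<subseteq> I"
  shows "mean I (\<lambda>x. walsh_sum I a x * walsh T x) = a T"
proof -
  have "mean I (\<lambda>x. walsh_sum I a x * walsh T x)
      = (\<Sum>S\<in>Pow I. a S * mean I (\<lambda>x. walsh S x * walsh T x))"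
    by (simp add: walsh_sum_def sum_distrib_right mult.assoc mean_sum mean_cmult)
  also have "\<dots> = (\<Sum>S\<in>Pow I. if S = T then a S else 0)"
    using assms by (intro sum.cong refl) (auto simp: mean_walsh_mult)
  also have "\<dots> = a T" using assms by (simp add: sum.delta')
  finally show ?thesis .
qed

lemma parseval:
  assumes "finite I"
  shows "mean I (\<lambda>x. (walsh_sum I a x)\<^sup>2) = (\<Sum>S\<in>Pow I. (a S)\<^sup>2)"
proof -
  have "mean I (\<lambda>x. (walsh_sum I a x)\<^sup>2)
      = mean I (\<lambda>x. \<Sum>S\<in>Pow I. a S * (walsh_sum I a x * walsh S x))"
    by (rule arg_cong[where f = "mean I"], rule ext)
      (simp add: power2_eq_square, subst (2) walsh_sum_def, simp add: sum_distrib_left mult_ac)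
  also have "\<dots> = (\<Sum>S\<in>Pow I. (a S)\<^sup>2)"
    unfolding mean_sum mean_cmult using assms
    by (intro sum.cong refl) (simp add: mean_walsh_sum_mult_walsh power2_eq_square)
  finally show ?thesis .
qed

text \<open>
  The kernel \<open>\<Sum>S. walsh S y * walsh S x\<close> factors as \<open>\<Prod>i. (1 + y i * x i)\<close>, which is
  \<open>2 ^ card I\<close> for \<open>y = x\<close> and has a vanishing factor otherwise.
\<close>

lemma walsh_inversion:
  assumes "finite I" "x \<in> sign_cube I"
  shows "walsh_sum I (\<lambda>S. mean I (\<lambda>y. f y * walsh S y)) x = f x"
proof -
  have kernel: "(\<Sum>S\<in>Pow I. walsh S y * walsh S x) = (if y = x then 2 ^ card I else 0)"
    if y: "y \<in> sign_cube I" for y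
  proof -
    have "(\<Sum>S\<in>Pow I. walsh S y * walsh S x) = (\<Prod>i\<in>I. y i * x i + 1)"
      using prod_add[OF assms(1), of "\<lambda>i. y i * x i" "\<lambda>_. 1"] by (simp add: walsh_def prod.distrib)
    also have "\<dots> = (if y = x then 2 ^ card I else 0)"
    proof (cases "y = x")
      case True
      have "(\<Prod>i\<in>I. y i * x i + 1) = (\<Prod>i\<in>I. 2)"
        using sign_cube_values[OF assms(2)] True by (intro prod.cong) force+
      then show ?thesis using True by simp
    next
      case False
      then obtain i where i: "i \<in> I" "y i \<noteq> x i"
        using y assms(2) unfolding sign_cube_def by (metis PiE_ext)
      have "y i * x i + 1 = 0"
        using i sign_cube_values[OF assms(2) i(1)] sign_cube_values[OF y i(1)] by auto
      then show ?thesis using False i(1) assms(1) by (auto intro!: prod_zero)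
    qed
    finally show ?thesis .
  qed
  have "walsh_sum I (\<lambda>S. mean I (\<lambda>y. f y * walsh S y)) x
      = mean I (\<lambda>y. \<Sum>S\<in>Pow I. walsh S x * (f y * walsh S y))"
    unfolding mean_sum mean_cmult walsh_sum_def by (simp add: mult.commute)
  also have "\<dots> = mean I (\<lambda>y. f y * (\<Sum>S\<in>Pow I. walsh S y * walsh S x))"
    by (simp add: sum_distrib_left mult_ac)
  also have "\<dots> = mean I (\<lambda>y. f y * (if y = x then 2 ^ card I else 0))"
    by (intro mean_cong) (simp add: kernel)
  also have "\<dots> = f x"
    using assms by (simp add: mean_def if_distrib[of "\<lambda>c. _ * c"] sum.delta cong: if_cong)
  finally show ?thesis .
qed

section \<open>Comparison of moments of functions of low degree\<close>

lemma mean_cauchy_schwarz: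
  "(mean I (\<lambda>x. f x * g x))\<^sup>2 \<le> mean I (\<lambda>x. (f x)\<^sup>2) * mean I (\<lambda>x. (g x)\<^sup>2)"
  using Cauchy_Schwarz_ineq_sum[of f g "sign_cube I"]
  by (simp add: mean_def power_divide divide_right_mono power2_eq_square)

text \<open>
  Bonami's inequality, by induction on the number of coordinates. Splitting off one coordinate
  writes the function as \<open>g + x i * h\<close>, where \<open>h\<close> has degree one less. Averaging over \<open>x i\<close>
  leaves \<open>g ^ 4 + 6 * g\<^sup>2 * h\<^sup>2 + h ^ 4\<close>, and the mixed term is controlled by Cauchy-Schwarz. The
  factor 9 per degree is what lets 6 times the geometric mean of the two constants, \<open>3 * 9 ^ (d - 1)\<close>,
  fit into the mixed term \<open>2 * 9 ^ d\<close> of the square.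
\<close>

theorem bonami_fourth_moment:
  assumes "finite I" and "\<And>S. S \<subseteq> I \<Longrightarrow> card S > d \<Longrightarrow> a S = 0"
  shows "mean I (\<lambda>x. (walsh_sum I a x) ^ 4) \<le> 9 ^ d * (mean I (\<lambda>x. (walsh_sum I a x)\<^sup>2))\<^sup>2"
  using assms
proof (induction I arbitrary: a d rule: finite_induct)
  case empty
  have "1 * a {} ^ 4 \<le> 9 ^ d * a {} ^ 4"
    by (rule mult_right_mono) auto
  then show ?case
    by (simp add: mean_def sign_cube_def walsh_sum_def walsh_def)
next
  case (insert i I)
  define g where "g = walsh_sum I a"
  define h where "h = walsh_sum I (\<lambda>S. a (insert i S))"
  have upd: "walsh_sum (insert i I) a (x(i := c)) = g x + c * h x" for x c
    using insert by (simp add: walsh_sum_insert walsh_sum_fun_upd g_def h_def)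
  have second: "mean (insert i I) (\<lambda>x. (walsh_sum (insert i I) a x)\<^sup>2)
      = mean I (\<lambda>x. (g x)\<^sup>2) + mean I (\<lambda>x. (h x)\<^sup>2)"
  proof -
    have "mean (insert i I) (\<lambda>x. (walsh_sum (insert i I) a x)\<^sup>2)
        = mean I (\<lambda>x. 1/2 * ((g x + h x)\<^sup>2 + (g x - h x)\<^sup>2))"
      unfolding mean_insert[OF insert(1,2)] upd mean_cmult mean_add by simp
    also have "\<dots> = mean I (\<lambda>x. (g x)\<^sup>2 + (h x)\<^sup>2)"
      by (rule mean_cong) (simp add: power2_eq_square algebra_simps)
    finally show ?thesis by (simp add: mean_add)
  qed
  have fourth: "mean (insert i I) (\<lambda>x. (walsh_sum (insert i I) a x) ^ 4)
      = mean I (\<lambda>x. g x ^ 4) + 6 * mean I (\<lambda>x. (g x)\<^sup>2 * (h x)\<^sup>2) + mean I (\<lambda>x. h x ^ 4)"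
  proof -
    have "mean (insert i I) (\<lambda>x. (walsh_sum (insert i I) a x) ^ 4)
        = mean I (\<lambda>x. 1/2 * ((g x + h x) ^ 4 + (g x - h x) ^ 4))"
      unfolding mean_insert[OF insert(1,2)] upd mean_cmult mean_add by simp
    also have "\<dots> = mean I (\<lambda>x. g x ^ 4 + 6 * ((g x)\<^sup>2 * (h x)\<^sup>2) + h x ^ 4)"
      by (rule mean_cong) (simp add: power2_eq_square power4_eq_xxxx algebra_simps)
    finally show ?thesis by (simp add: mean_add mean_cmult)
  qed
  define A where "A = mean I (\<lambda>x. (g x)\<^sup>2)"
  define B where "B = mean I (\<lambda>x. (h x)\<^sup>2)"
  have AB: "A \<ge> 0" "B \<ge> 0" unfolding A_def B_def by (auto intro: mean_nonneg)
  have G: "mean I (\<lambda>x. g x ^ 4) \<le> 9 ^ d * A\<^sup>2"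
    unfolding g_def A_def by (rule insert.IH) (use insert.prems in auto)
  show ?case
  proof (cases d)
    case 0
    have "h x = 0" for x
      unfolding h_def walsh_sum_def
    proof (rule sum.neutral, rule ballI)
      fix S assume S: "S \<in> Pow I"
      then have "finite S" using insert(1) by (auto intro: finite_subset)
      then have "card (insert i S) > 0" by (simp add: card_gt_0_iff)
      then show "a (insert i S) * walsh S x = 0" using insert.prems[of "insert i S"] S 0 by auto
    qed
    then show ?thesis unfolding second fourth using G by (simp add: A_def mean_def)
  next
    case (Suc e)
    have H: "mean I (\<lambda>x. h x ^ 4) \<le> 9 ^ e * B\<^sup>2"
      unfolding h_def B_def
    proof (rule insert.IH)
      fix S assume S: "S \<subseteq> I" "card S > e"
      then have "card (insert i S) > d"
        using insert(1,2) Suc by (subst card_insert_disjoint) (auto intro: finite_subset)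
      then show "a (insert i S) = 0" using insert.prems[of "insert i S"] S by auto
    qed
    have "(mean I (\<lambda>x. (g x)\<^sup>2 * (h x)\<^sup>2))\<^sup>2 \<le> mean I (\<lambda>x. g x ^ 4) * mean I (\<lambda>x. h x ^ 4)"
      using mean_cauchy_schwarz[of I "\<lambda>x. (g x)\<^sup>2" "\<lambda>x. (h x)\<^sup>2"] by simp
    also have "\<dots> \<le> (9 ^ d * A\<^sup>2) * (9 ^ e * B\<^sup>2)"
      using G H by (intro mult_mono) (auto intro: mean_nonneg)
    also have "\<dots> = (3 * 9 ^ e * (A * B))\<^sup>2"
      by (simp add: Suc power_mult_distrib power2_eq_square)
    finally have "mean I (\<lambda>x. (g x)\<^sup>2 * (h x)\<^sup>2) \<le> 3 * 9 ^ e * (A * B)"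
      by (rule power2_le_imp_le) (use AB in auto)
    moreover have "9 ^ e * B\<^sup>2 \<le> 9 ^ d * B\<^sup>2" by (simp add: Suc mult_right_mono)
    ultimately have "mean I (\<lambda>x. g x ^ 4) + 6 * mean I (\<lambda>x. (g x)\<^sup>2 * (h x)\<^sup>2)
        + mean I (\<lambda>x. h x ^ 4) \<le> 9 ^ d * A\<^sup>2 + 6 * (3 * 9 ^ e * (A * B)) + 9 ^ d * B\<^sup>2"
      using G H by linarith
    also have "\<dots> = 9 ^ d * (A + B)\<^sup>2"
      by (simp add: Suc power2_eq_square algebra_simps)
    finally show ?thesis unfolding second fourth A_def B_def .
  qed
qed

lemma holder_sum:
  fixes a b :: "'i \<Rightarrow> real"
  assumes "finite X" and a: "\<And>i. i \<in> X \<Longrightarrow> 0 \<le> a i" and b: "\<And>i. i \<in> X \<Longrightarrow> 0 \<le> b i"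
    and w: "0 < \<alpha>" "0 < \<beta>" "\<alpha> + \<beta> = 1"
  shows "(\<Sum>i\<in>X. a i powr \<alpha> * b i powr \<beta>) \<le> (\<Sum>i\<in>X. a i) powr \<alpha> * (\<Sum>i\<in>X. b i) powr \<beta>"
proof -
  define A where "A = (\<Sum>i\<in>X. a i)"
  define B where "B = (\<Sum>i\<in>X. b i)"
  have AB: "A \<ge> 0" "B \<ge> 0" unfolding A_def B_def using a b by (auto intro: sum_nonneg)
  show ?thesis
  proof (cases "A = 0 \<or> B = 0")
    case True
    then have "(\<Sum>i\<in>X. a i powr \<alpha> * b i powr \<beta>) = 0"
      unfolding A_def B_def using assms
      by (auto simp: sum_nonneg_eq_0_iff intro!: sum.neutral)
    then show ?thesis by simp
  next
    case False
    then have pos: "A > 0" "B > 0" using AB by auto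
    have "a i powr \<alpha> * b i powr \<beta> \<le> A powr \<alpha> * B powr \<beta> * (\<alpha> * (a i / A) + \<beta> * (b i / B))"
      if i: "i \<in> X" for i
    proof (cases "a i = 0 \<or> b i = 0")
      case True
      then show ?thesis using a[OF i] b[OF i] pos w by auto
    next
      case False
      then have "a i > 0" "b i > 0" using a[OF i] b[OF i] by auto
      then have "(a i / A) powr \<alpha> * (b i / B) powr \<beta> \<le> \<alpha> * (a i / A) + \<beta> * (b i / B)"
        using pos w by (intro Youngs_inequality_0) auto
      then have "A powr \<alpha> * B powr \<beta> * ((a i / A) powr \<alpha> * (b i / B) powr \<beta>)
          \<le> A powr \<alpha> * B powr \<beta> * (\<alpha> * (a i / A) + \<beta> * (b i / B))"
        by (rule mult_left_mono) simp
      then show ?thesis using pos \<open>a i > 0\<close> \<open>b i > 0\<close> by (simp add: powr_divide)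
    qed
    then have "(\<Sum>i\<in>X. a i powr \<alpha> * b i powr \<beta>)
        \<le> (\<Sum>i\<in>X. A powr \<alpha> * B powr \<beta> * (\<alpha> * (a i / A) + \<beta> * (b i / B)))"
      by (rule sum_mono)
    also have "\<dots> = A powr \<alpha> * B powr \<beta> * (\<alpha> * (A / A) + \<beta> * (B / B))"
      unfolding sum_distrib_left[symmetric] sum.distrib sum_divide_distrib[symmetric]
      by (simp only: A_def B_def)
    also have "\<dots> = A powr \<alpha> * B powr \<beta>" using pos w by simp
    finally show ?thesis unfolding A_def B_def .
  qed
qed

lemma mean_holder:
  assumes "finite I" and "\<And>x. x \<in> sign_cube I \<Longrightarrow> 0 \<le> f x" "\<And>x. x \<in> sign_cube I \<Longrightarrow> 0 \<le> g x"
    and w: "0 < \<alpha>" "0 < \<beta>" "\<alpha> + \<beta> = 1"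
  shows "mean I (\<lambda>x. f x powr \<alpha> * g x powr \<beta>) \<le> mean I f powr \<alpha> * mean I g powr \<beta>"
proof -
  have "(2 ^ card I) powr \<alpha> * (2 ^ card I) powr \<beta> = (2::real) ^ card I"
    using w by (simp flip: powr_add)
  moreover have "mean I f powr \<alpha> * mean I g powr \<beta> = (\<Sum>x\<in>sign_cube I. f x) powr \<alpha>
      * (\<Sum>x\<in>sign_cube I. g x) powr \<beta> / ((2 ^ card I) powr \<alpha> * (2 ^ card I) powr \<beta>)"
    using assms by (simp add: mean_def powr_divide sum_nonneg)
  ultimately show ?thesis
    using holder_sum[OF finite_sign_cube[OF assms(1)] assms(2,3) w]
    by (simp add: mean_def divide_right_mono)
qed

text \<open>
  Interpolation in place of sharp hypercontractivity: Hoelder's inequality bounds the \<open>L\<^sup>2\<close> norm by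
  a geometric mean of the \<open>L\<^sup>p\<close> and the \<open>L\<^sup>4\<close> norm, and Bonami's inequality returns the \<open>L\<^sup>4\<close> norm
  to the \<open>L\<^sup>2\<close> norm, which is then absorbed. As \<open>p = 2 * k / (k + 1)\<close> tends to 2 the weight on
  \<open>L\<^sup>4\<close> tends to 0, and this turns the cost \<open>3 ^ d\<close> of passing to \<open>L\<^sup>1\<close> into \<open>3 powr (d / k)\<close>.
\<close>

theorem l2_norm_le_lp_norm:
  fixes k d :: nat
  assumes I: "finite I" and deg: "\<And>S. S \<subseteq> I \<Longrightarrow> card S > d \<Longrightarrow> a S = 0" and k: "k \<ge> 1"
    and p: "p = 2 * real k / (real k + 1)"
  shows "sqrt (mean I (\<lambda>x. (walsh_sum I a x)\<^sup>2))
       \<le> 3 powr (real d / real k) * (mean I (\<lambda>x. \<bar>walsh_sum I a x\<bar> powr p)) powr (1 / p)"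
proof -
  define V where "V = mean I (\<lambda>x. (walsh_sum I a x)\<^sup>2)"
  define P where "P = mean I (\<lambda>x. \<bar>walsh_sum I a x\<bar> powr p)"
  define F where "F = mean I (\<lambda>x. (walsh_sum I a x) ^ 4)"
  define \<alpha> where "\<alpha> = (real k + 1) / (real k + 2)"
  define \<beta> where "\<beta> = 1 / (real k + 2)"
  have w: "0 < \<alpha>" "0 < \<beta>" "\<alpha> + \<beta> = 1" using k by (auto simp: \<alpha>_def \<beta>_def field_simps)
  have exps: "p * \<alpha> + 4 * \<beta> = 2" using k by (simp add: p \<alpha>_def \<beta>_def divide_simps)
  have V0: "V \<ge> 0" unfolding V_def by (auto intro: mean_nonneg)
  have pos: "P \<ge> 0" "F \<ge> 0" unfolding P_def F_def by (auto intro: mean_nonneg)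
  have "(h::real)\<^sup>2 = (\<bar>h\<bar> powr p) powr \<alpha> * (h ^ 4) powr \<beta>" for h
  proof (cases "h = 0")
    case False
    have h4: "h ^ 4 = \<bar>h\<bar> powr 4" using False by simp
    have "(\<bar>h\<bar> powr p) powr \<alpha> * (h ^ 4) powr \<beta> = \<bar>h\<bar> powr (p * \<alpha> + 4 * \<beta>)"
      unfolding h4 by (simp only: powr_powr powr_add)
    then show ?thesis using False by (simp add: exps)
  qed simp
  then have "V = mean I (\<lambda>x. (\<bar>walsh_sum I a x\<bar> powr p) powr \<alpha> * ((walsh_sum I a x) ^ 4) powr \<beta>)"
    unfolding V_def by (intro mean_cong)
  also have "\<dots> \<le> P powr \<alpha> * F powr \<beta>"
    unfolding P_def F_def by (intro mean_holder I w) auto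
  also have "\<dots> \<le> P powr \<alpha> * (9 ^ d * V\<^sup>2) powr \<beta>"
    using bonami_fourth_moment[of I d a] I deg w pos
    by (intro mult_left_mono powr_mono2) (auto simp: V_def F_def)
  finally have main: "V \<le> P powr \<alpha> * (9 ^ d * V\<^sup>2) powr \<beta>" .
  show ?thesis
  proof (cases "V = 0")
    case True
    then show ?thesis by (simp add: V_def[symmetric])
  next
    case False
    then have V: "V > 0" using V0 by simp
    then have P: "P > 0" using main pos by (cases "P = 0") auto
    have "ln V \<le> ln (P powr \<alpha> * (9 ^ d * V\<^sup>2) powr \<beta>)"
      using main V P by simp
    also have "\<dots> = \<alpha> * ln P + \<beta> * (2 * real d * ln 3 + 2 * ln V)"
    proof -
      have "ln ((9::real) ^ d) = 2 * real d * ln 3"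
        using ln_realpow[of "3::real" "2"] by (simp add: ln_realpow)
      then show ?thesis using V P by (simp add: ln_mult ln_powr ln_realpow)
    qed
    finally have "ln V * (real k + 2) \<le> (\<alpha> * ln P + \<beta> * (2 * real d * ln 3 + 2 * ln V)) * (real k + 2)"
      by (rule mult_right_mono) simp
    also have "\<dots> = \<alpha> * (real k + 2) * ln P + \<beta> * (real k + 2) * (2 * real d * ln 3 + 2 * ln V)"
      by algebra
    also have "\<dots> = (real k + 1) * ln P + (2 * real d * ln 3 + 2 * ln V)"
      by (simp add: \<alpha>_def \<beta>_def)
    finally have "real k * ln V \<le> (real k + 1) * ln P + 2 * real d * ln 3"
      by (simp add: algebra_simps)
    then have "ln V / 2 \<le> real d / real k * ln 3 + 1 / p * ln P"
      using k by (simp add: p field_simps)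
    then have "exp (ln V / 2) \<le> exp (real d / real k * ln 3 + 1 / p * ln P)"
      by simp
    moreover have "exp (ln V / 2) = sqrt V"
      using V by (simp add: powr_half_sqrt[symmetric] powr_def)
    ultimately show ?thesis using P by (simp add: V_def P_def powr_def exp_add)
  qed
qed

section \<open>Coefficients of polynomials bounded on an interval\<close>

fun chebyshev :: "nat \<Rightarrow> real poly" where
  "chebyshev 0 = 1"
| "chebyshev (Suc 0) = [:0, 1:]"
| "chebyshev (Suc (Suc n)) = [:0, 2:] * chebyshev (Suc n) - chebyshev n"

lemma coeff_linear_mult: "coeff ([:0, c:] * q) k = (case k of 0 \<Rightarrow> 0 | Suc j \<Rightarrow> c * coeff q j)"
  by (cases k) simp_all

lemma poly_chebyshev_cos: "poly (chebyshev n) (cos t) = cos (real n * t)"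
proof (induction n rule: chebyshev.induct)
  case (3 n)
  have "cos (real (Suc (Suc n)) * t) + cos (real n * t) = 2 * cos (real (Suc n) * t) * cos t"
    using cos_times_cos[of "real (Suc n) * t" t] by (simp add: algebra_simps)
  then show ?case using 3 by (simp add: algebra_simps)
qed simp_all

text \<open>
  By the triangle inequality in the recurrence, the induction step reduces to
  \<open>2 * (n + 1) ^ j + n * n ^ j \<le> (n + 2) ^ (j + 1)\<close>.
\<close>

lemma abs_coeff_chebyshev_le: "\<bar>coeff (chebyshev n) k\<bar> \<le> real n ^ k"
proof (induction n arbitrary: k rule: chebyshev.induct)
  case 1
  then show ?case by (cases k) simp_all
next
  case 2
  then show ?case by (cases k) (auto simp: coeff_pCons split: nat.split)
next
  case (3 n)
  show ?case
  proof (cases k)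
    case 0
    then show ?thesis using "3.IH"(2)[of 0] by simp
  next
    case (Suc j)
    have "\<bar>coeff (chebyshev (Suc (Suc n))) k\<bar>
        \<le> 2 * \<bar>coeff (chebyshev (Suc n)) j\<bar> + \<bar>coeff (chebyshev n) (Suc j)\<bar>"
      by (simp add: Suc coeff_linear_mult)
    also have "\<dots> \<le> 2 * real (Suc n) ^ j + real n * real n ^ j"
      using "3.IH"(1)[of j] "3.IH"(2)[of "Suc j"] by simp
    also have "\<dots> \<le> 2 * real (Suc (Suc n)) ^ j + real n * real (Suc (Suc n)) ^ j"
      by (intro add_mono mult_left_mono power_mono) auto
    also have "\<dots> = real (Suc (Suc n)) ^ k" by (simp add: Suc algebra_simps)
    finally show ?thesis .
  qed
qed

lemma coeff_chebyshev_eq_0: "k > n \<Longrightarrow> coeff (chebyshev n) k = 0"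
proof (induction n arbitrary: k rule: chebyshev.induct)
  case (3 n)
  then show ?case by (cases k) (simp_all add: coeff_linear_mult)
qed (auto simp: coeff_pCons split: nat.splits)

lemma coeff_chebyshev_lead_pos: "coeff (chebyshev n) n > 0"
  by (induction n rule: chebyshev.induct) (simp_all add: coeff_linear_mult coeff_chebyshev_eq_0)

lemma chebyshev_expansion:
  "degree p \<le> m \<Longrightarrow> \<exists>c. p = (\<Sum>n\<le>m. smult (c n) (chebyshev n))"
proof (induction m arbitrary: p)
  case 0
  then obtain e where "p = [:e:]" by (auto elim: degree_eq_zeroE)
  then show ?case by (intro exI[of _ "\<lambda>_. e"]) simp
next
  case (Suc m)
  \<comment> \<open>Subtracting this multiple of the Chebyshev polynomial removes the leading term.\<close>
  define t where "t = coeff p (Suc m) / coeff (chebyshev (Suc m)) (Suc m)"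
  define q where "q = p - smult t (chebyshev (Suc m))"
  have "degree q \<le> m"
  proof (rule degree_le, intro allI impI)
    fix i assume "m < i"
    then consider "i = Suc m" | "i > Suc m" by linarith
    then show "coeff q i = 0"
    proof cases
      case 1
      then show ?thesis
        using coeff_chebyshev_lead_pos[of "Suc m"] by (simp add: q_def t_def del: chebyshev.simps)
    next
      case 2
      then show ?thesis
        using Suc.prems by (simp add: q_def coeff_chebyshev_eq_0 coeff_eq_0 del: chebyshev.simps)
    qed
  qed
  then obtain c where c: "q = (\<Sum>n\<le>m. smult (c n) (chebyshev n))" using Suc.IH by blast
  have "p = q + smult t (chebyshev (Suc m))" by (simp add: q_def)
  also have "\<dots> = (\<Sum>n\<le>Suc m. smult ((c(Suc m := t)) n) (chebyshev n))"
    unfolding c by (simp del: chebyshev.simps)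
  finally show ?case by blast
qed

lemma sum_cos_equidistant:
  assumes "0 < j" "j < M"
  shows "(\<Sum>l<M. cos (real j * (2 * pi * real l / real M))) = 0"
proof -
  define z where "z = cis (2 * pi * real j / real M)"
  have "z ^ M = cis (2 * pi * real j)" using assms by (simp add: z_def DeMoivre)
  then have zM: "z ^ M = 1" by (simp add: cis_multiple_2pi)
  have "z \<noteq> 1"
  proof
    assume "z = 1"
    then have "cos (2 * pi * real j / real M) = 1" by (metis Re_complex_of_real cis.simps(1) of_real_1 z_def)
    then obtain n :: int where "2 * pi * real j / real M = of_int n * 2 * pi"
      using cos_one_2pi_int by blast
    then have "real j = of_int n * real M" using assms by (simp add: field_simps)
    then have "int j = n * int M" by (metis of_int_eq_iff of_int_mult of_int_of_nat_eq)
    then have "int M dvd int j" by simp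
    then show False using assms by (simp add: nat_dvd_not_less)
  qed
  then have "(\<Sum>l<M. z ^ l) = 0" using zM by (simp add: geometric_sum)
  then have "Re (\<Sum>l<M. z ^ l) = 0" by simp
  moreover have "Re (z ^ l) = cos (real j * (2 * pi * real l / real M))" for l
    by (simp add: z_def DeMoivre mult_ac)
  ultimately show ?thesis by simp
qed

text \<open>
  With \<open>2 * m + 1\<close> nodes none of the frequencies \<open>n - k\<close> and \<open>n + k\<close>, which are at most \<open>2 * m\<close>,
  wraps around to 0, so the sampled cosines are exactly orthogonal.
\<close>

lemma sum_cos_mult_cos_equidistant:
  assumes "n \<le> m" "k \<le> m"
  defines "\<theta> \<equiv> \<lambda>l. 2 * pi * real l / real (2 * m + 1)"
  shows "(\<Sum>l<2 * m + 1. cos (real n * \<theta> l) * cos (real k * \<theta> l))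
       = (if n = k then if k = 0 then real (2 * m + 1) else real (2 * m + 1) / 2 else 0)"
proof -
  define d where "d = (if n \<le> k then k - n else n - k)"
  have "cos (real n * t) * cos (real k * t) = (cos (real d * t) + cos (real (n + k) * t)) / 2" for t
  proof -
    have "cos (real d * t) = cos (real n * t) * cos (real k * t) + sin (real n * t) * sin (real k * t)"
      by (auto simp: d_def of_nat_diff algebra_simps cos_diff)
    moreover have "cos (real (n + k) * t)
        = cos (real n * t) * cos (real k * t) - sin (real n * t) * sin (real k * t)"
      by (simp add: algebra_simps cos_add)
    ultimately show ?thesis by simp
  qed
  then have product: "(\<Sum>l<2 * m + 1. cos (real n * \<theta> l) * cos (real k * \<theta> l))
      = ((\<Sum>l<2 * m + 1. cos (real d * \<theta> l)) + (\<Sum>l<2 * m + 1. cos (real (n + k) * \<theta> l))) / 2"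
    by (simp only: sum_divide_distrib[symmetric] sum.distrib[symmetric])
  have cos_sum: "(\<Sum>l<2 * m + 1. cos (real j * \<theta> l)) = (if j = 0 then real (2 * m + 1) else 0)"
    if "j < 2 * m + 1" for j
    using sum_cos_equidistant[of j "2 * m + 1"] that unfolding \<theta>_def by simp
  have "d < 2 * m + 1" "n + k < 2 * m + 1" using assms by (auto simp: d_def)
  then have "(\<Sum>l<2 * m + 1. cos (real n * \<theta> l) * cos (real k * \<theta> l))
      = ((if d = 0 then real (2 * m + 1) else 0) + (if n + k = 0 then real (2 * m + 1) else 0)) / 2"
    unfolding product by (simp only: cos_sum)
  moreover have "d = 0 \<longleftrightarrow> n = k" by (auto simp: d_def)
  ultimately show ?thesis by (simp only: add_is_0) simp
qed

text \<open>
  The coefficient is recovered by sampling \<open>p\<close> at the cosines of equidistant angles and pairing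
  the samples with \<open>cos (k * \<theta>)\<close>.
\<close>

lemma abs_chebyshev_coefficient_le:
  assumes p: "p = (\<Sum>n\<le>m. smult (c n) (chebyshev n))"
    and bound: "\<And>u. \<bar>u\<bar> \<le> 1 \<Longrightarrow> \<bar>poly p u\<bar> \<le> B" and k: "k \<le> m"
  shows "\<bar>c k\<bar> \<le> 2 * B"
proof -
  define \<theta> where "\<theta> l = 2 * pi * real l / real (2 * m + 1)" for l
  have "(\<Sum>l<2 * m + 1. poly p (cos (\<theta> l)) * cos (real k * \<theta> l))
      = (\<Sum>n\<le>m. c n * (\<Sum>l<2 * m + 1. cos (real n * \<theta> l) * cos (real k * \<theta> l)))"
    unfolding p poly_sum poly_smult poly_chebyshev_cos sum_distrib_left sum_distrib_right
    by (subst sum.swap) (simp only: mult.assoc)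
  also have "\<dots> = (\<Sum>n\<le>m. if n = k
      then c k * (if k = 0 then real (2 * m + 1) else real (2 * m + 1) / 2) else 0)"
    unfolding \<theta>_def using k by (intro sum.cong refl, subst sum_cos_mult_cos_equidistant) auto
  also have "\<dots> = c k * (if k = 0 then real (2 * m + 1) else real (2 * m + 1) / 2)"
    using k by (simp add: sum.delta del: of_nat_add of_nat_mult)
  finally have eq: "c k * (if k = 0 then real (2 * m + 1) else real (2 * m + 1) / 2)
      = (\<Sum>l<2 * m + 1. poly p (cos (\<theta> l)) * cos (real k * \<theta> l))" ..
  have "\<bar>c k\<bar> * (real (2 * m + 1) / 2)
      \<le> \<bar>c k * (if k = 0 then real (2 * m + 1) else real (2 * m + 1) / 2)\<bar>"
    unfolding abs_mult by (rule mult_left_mono) auto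
  also have "\<dots> \<le> (\<Sum>l<2 * m + 1. \<bar>poly p (cos (\<theta> l)) * cos (real k * \<theta> l)\<bar>)"
    unfolding eq by (rule sum_abs)
  also have "\<dots> \<le> (\<Sum>l<2 * m + 1. B * 1)"
    unfolding abs_mult using bound[of 0]
    by (intro sum_mono mult_mono bound) auto
  finally have "real (2 * m + 1) / 2 * \<bar>c k\<bar> \<le> real (2 * m + 1) / 2 * (2 * B)"
    by (simp add: mult.commute)
  then show ?thesis by (rule mult_left_le_imp_le) simp
qed

text \<open>
  A weak form of Markov's inequality for coefficients. All that matters later is that the loss
  is polynomial in \<open>m\<close>, with an exponent of the order of \<open>k\<close>. It follows from the Chebyshev
  expansion: each of the \<open>m + 1\<close> coefficients of the expansion is at most \<open>2 * B\<close>, and the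
  \<open>k\<close>-th coefficient of each of the Chebyshev polynomials is at most \<open>m ^ k\<close>.
\<close>

theorem abs_coeff_le_of_bounded:
  fixes p :: "real poly"
  assumes "degree p \<le> m" and "\<And>u. \<bar>u\<bar> \<le> 1 \<Longrightarrow> \<bar>poly p u\<bar> \<le> B"
  shows "\<bar>coeff p k\<bar> \<le> 2 * real (m + 1) * real m ^ k * B"
proof -
  obtain c where c: "p = (\<Sum>n\<le>m. smult (c n) (chebyshev n))"
    using chebyshev_expansion[OF assms(1)] by blast
  have B: "0 \<le> B" using assms(2)[of 0] by simp
  have "\<bar>coeff p k\<bar> = \<bar>\<Sum>n\<le>m. c n * coeff (chebyshev n) k\<bar>"
    by (simp add: c coeff_sum)
  also have "\<dots> \<le> (\<Sum>n\<le>m. \<bar>c n\<bar> * \<bar>coeff (chebyshev n) k\<bar>)"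
    unfolding abs_mult[symmetric] by (rule sum_abs)
  also have "\<dots> \<le> (\<Sum>n\<le>m. (2 * B) * real m ^ k)"
  proof (intro sum_mono mult_mono)
    fix n assume "n \<in> {..m}"
    then show "\<bar>c n\<bar> \<le> 2 * B" by (intro abs_chebyshev_coefficient_le[OF c assms(2)]) auto
    have "\<bar>coeff (chebyshev n) k\<bar> \<le> real n ^ k" by (rule abs_coeff_chebyshev_le)
    also have "\<dots> \<le> real m ^ k" using \<open>n \<in> {..m}\<close> by (intro power_mono) auto
    finally show "\<bar>coeff (chebyshev n) k\<bar> \<le> real m ^ k" .
  qed (use B in auto)
  finally show ?thesis by (simp add: algebra_simps)
qed

section \<open>Discrete derivatives and polarization\<close>

text \<open>
  The Walsh coefficients of the iterated discrete derivative in the directions \<open>T\<close>: the part of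
  the function that is divisible by \<open>walsh T\<close>, divided by \<open>walsh T\<close>.
\<close>

definition partial_coeff :: "nat set \<Rightarrow> (nat set \<Rightarrow> real) \<Rightarrow> nat set \<Rightarrow> real" where
  "partial_coeff T a R = (if R \<inter> T = {} then a (R \<union> T) else 0)"

lemma sum_disjoint_eq_sum_superset:
  fixes g :: "'a set \<Rightarrow> 'a set \<Rightarrow> real"
  assumes "finite I" "T \<subseteq> I"
  shows "(\<Sum>R\<in>Pow I. if R \<inter> T = {} then g (R \<union> T) R else 0)
       = (\<Sum>S\<in>{S \<in> Pow I. T \<subseteq> S}. g S (S - T))"
proof -
  have "(\<Sum>R\<in>Pow I. if R \<inter> T = {} then g (R \<union> T) R else 0)
      = (\<Sum>R\<in>{R \<in> Pow I. R \<inter> T = {}}. g (R \<union> T) R)"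
    using assms by (simp only: sum.inter_filter finite_Pow_iff)
  also have "\<dots> = (\<Sum>S\<in>{S \<in> Pow I. T \<subseteq> S}. g S (S - T))"
  proof (rule sum.reindex_bij_witness[where i = "\<lambda>S. S - T" and j = "\<lambda>R. R \<union> T"])
    fix R assume R: "R \<in> {R \<in> Pow I. R \<inter> T = {}}"
    then show e: "R \<union> T - T = R" by auto
    show "g (R \<union> T) (R \<union> T - T) = g (R \<union> T) R" by (simp only: e)
    show "R \<union> T \<in> {S \<in> Pow I. T \<subseteq> S}" using R assms by auto
  qed (use assms in auto)
  finally show ?thesis .
qed

lemma walsh_sum_partial:
  assumes "finite I" "T \<subseteq> I"
  shows "walsh_sum I (partial_coeff T a) x = (\<Sum>S\<in>{S \<in> Pow I. T \<subseteq> S}. a S * walsh (S - T) x)"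
  using sum_disjoint_eq_sum_superset[OF assms, of "\<lambda>S R. a S * walsh R x"]
  by (simp add: walsh_sum_def partial_coeff_def if_distrib[of "\<lambda>c. c * _"] cong: if_cong)

lemma mean_square_partial:
  assumes "finite I" "T \<subseteq> I"
  shows "mean I (\<lambda>x. (walsh_sum I (partial_coeff T a) x)\<^sup>2) = (\<Sum>S\<in>{S \<in> Pow I. T \<subseteq> S}. (a S)\<^sup>2)"
  using sum_disjoint_eq_sum_superset[OF assms, of "\<lambda>S R. (a S)\<^sup>2"]
  by (simp add: parseval assms partial_coeff_def if_distrib[of "\<lambda>c. c\<^sup>2"] cong: if_cong)

lemma partial_homogeneous:
  assumes "finite I" "T \<subseteq> I" and hom: "\<And>S. S \<subseteq> I \<Longrightarrow> card S \<noteq> m \<Longrightarrow> a S = 0"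
    and R: "R \<subseteq> I" "card R + card T \<noteq> m"
  shows "partial_coeff T a R = 0"
proof (cases "R \<inter> T = {}")
  case True
  have "finite R" "finite T" using assms by (auto intro: finite_subset)
  then have "card (R \<union> T) \<noteq> m" using R True by (simp add: card_Un_disjoint)
  then show ?thesis using hom[of "R \<union> T"] R assms by (auto simp: partial_coeff_def)
qed (simp add: partial_coeff_def)

text \<open>
  The Taylor formula. The function is affine in every coordinate, so its derivative in the
  directions \<open>T\<close> at \<open>x\<close> is the coefficient of \<open>walsh T y\<close> in the expansion around \<open>x\<close>.
\<close>

lemma walsh_sum_shift:
  assumes I: "finite I"
  shows "walsh_sum I a (\<lambda>i. x i + u * y i)
       = (\<Sum>T\<in>Pow I. u ^ card T * (walsh_sum I (partial_coeff T a) x * walsh T y))"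
proof -
  have expand: "walsh S (\<lambda>i. x i + u * y i)
      = (\<Sum>T\<in>Pow I. if T \<subseteq> S then u ^ card T * (walsh (S - T) x * walsh T y) else 0)"
    if S: "S \<subseteq> I" for S
  proof -
    have "walsh S (\<lambda>i. x i + u * y i)
        = (\<Sum>T\<in>Pow S. (\<Prod>i\<in>T. u * y i) * (\<Prod>i\<in>S - T. x i))"
      unfolding walsh_def
      using prod_add[OF finite_subset[OF S I], of "\<lambda>i. u * y i" x] by (simp add: add.commute)
    also have "\<dots> = (\<Sum>T\<in>{T \<in> Pow I. T \<subseteq> S}. u ^ card T * (walsh (S - T) x * walsh T y))"
      using S by (intro sum.cong) (auto simp: walsh_def prod.distrib)
    also have "\<dots> = (\<Sum>T\<in>Pow I. if T \<subseteq> S then u ^ card T * (walsh (S - T) x * walsh T y) else 0)"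
      using I by (simp only: sum.inter_filter finite_Pow_iff)
    finally show ?thesis .
  qed
  have "walsh_sum I a (\<lambda>i. x i + u * y i)
      = (\<Sum>S\<in>Pow I. \<Sum>T\<in>Pow I. if T \<subseteq> S then a S * (u ^ card T * (walsh (S - T) x * walsh T y)) else 0)"
    unfolding walsh_sum_def
    by (intro sum.cong refl) (simp add: expand sum_distrib_left if_distrib[of "\<lambda>c. _ * c"] cong: if_cong)
  also have "\<dots> = (\<Sum>T\<in>Pow I. \<Sum>S\<in>{S \<in> Pow I. T \<subseteq> S}.
      a S * (u ^ card T * (walsh (S - T) x * walsh T y)))"
    using I by (subst sum.swap) (simp only: sum.inter_filter finite_Pow_iff)
  also have "\<dots> = (\<Sum>T\<in>Pow I. u ^ card T * (walsh_sum I (partial_coeff T a) x * walsh T y))"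
    using I by (intro sum.cong refl)
      (simp add: walsh_sum_partial sum_distrib_left sum_distrib_right mult_ac)
  finally show ?thesis .
qed

text \<open>
  The multilinear extension is affine in each coordinate, so moving one coordinate after the
  other to an endpoint of \<open>{-1..1}\<close> does not decrease the maximum.
\<close>

lemma walsh_sum_bound_solid_cube:
  assumes "finite I" and "\<And>x. x \<in> sign_cube I \<Longrightarrow> \<bar>walsh_sum I a x\<bar> \<le> B"
    and "\<And>i. i \<in> I \<Longrightarrow> \<bar>z i\<bar> \<le> 1"
  shows "\<bar>walsh_sum I a z\<bar> \<le> B"
  using assms
proof (induction I arbitrary: a rule: finite_induct)
  case empty
  then show ?case by (simp add: sign_cube_def walsh_sum_def walsh_def)
next
  case (insert i I)
  \<comment> \<open>Freezing the coordinate \<open>i\<close> at \<open>z i\<close> gives the Walsh coefficients of a function on the smaller cube.\<close>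
  define b where "b S = a S + z i * a (insert i S)" for S
  have W: "walsh_sum I b x = walsh_sum I a x + z i * walsh_sum I (\<lambda>S. a (insert i S)) x" for x
    by (simp add: walsh_sum_def b_def sum.distrib sum_distrib_left algebra_simps)
  have "\<bar>walsh_sum I b z\<bar> \<le> B"
  proof (rule insert.IH)
    fix x assume x: "x \<in> sign_cube I"
    define g where "g = walsh_sum I a x"
    define h where "h = walsh_sum I (\<lambda>S. a (insert i S)) x"
    have end_point: "\<bar>g + c * h\<bar> \<le> B" if "c \<in> {-1, 1}" for c
    proof -
      have "x(i := c) \<in> sign_cube (insert i I)"
        using x that insert(2) by (auto simp: sign_cube_def PiE_def extensional_def)
      then show ?thesis
        using insert.prems(1)[of "x(i := c)"]
        unfolding walsh_sum_insert[OF insert(1,2)] walsh_sum_fun_upd[OF insert(2)] g_def h_def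
        by (simp only: fun_upd_same)
    qed
    have "\<bar>z i * h\<bar> \<le> 1 * \<bar>h\<bar>"
      unfolding abs_mult using insert.prems(2)[of i] by (intro mult_right_mono) auto
    then show "\<bar>walsh_sum I b x\<bar> \<le> B"
      unfolding W using end_point[of 1] end_point[of "-1"] by (simp flip: g_def h_def)
  qed (use insert.prems in auto)
  then show ?case using insert(1,2) by (simp add: W walsh_sum_insert)
qed

text \<open>
  Along the line \<open>x + (u / m) * y\<close> the function is a polynomial in \<open>u\<close> whose \<open>j\<close>-th coefficient is
  the sum in question divided by \<open>m ^ j\<close>. For \<open>\<bar>u\<bar> \<le> 1\<close> the line leaves the solid cube, but only
  by the factor \<open>1 + 1 / m\<close>, which by homogeneity costs at most \<open>(1 + 1 / m) ^ m \<le> 3\<close>. So the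
  polynomial is bounded on \<open>{-1..1}\<close>, and so are its coefficients.
\<close>

theorem polarization_bound:
  assumes I: "finite I" and hom: "\<And>S. S \<subseteq> I \<Longrightarrow> card S \<noteq> m \<Longrightarrow> a S = 0" and m: "m \<ge> 1"
    and bound: "\<And>x. x \<in> sign_cube I \<Longrightarrow> \<bar>walsh_sum I a x\<bar> \<le> B"
    and x: "x \<in> sign_cube I" and y: "y \<in> sign_cube I"
  shows "\<bar>\<Sum>T\<in>{T \<in> Pow I. card T = j}. walsh_sum I (partial_coeff T a) x * walsh T y\<bar>
       \<le> 12 * real m ^ (2 * j + 1) * B"
proof -
  define G where "G j = (\<Sum>T\<in>{T \<in> Pow I. card T = j}. walsh_sum I (partial_coeff T a) x * walsh T y)" for j
  have B: "B \<ge> 0" using bound[OF x] by simp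
  have vanish: "walsh_sum I (partial_coeff T a) x = 0" if T: "T \<subseteq> I" "card T > m" for T
    unfolding walsh_sum_def using T partial_homogeneous[OF I T(1) hom]
    by (intro sum.neutral ballI) auto
  define p where "p = (\<Sum>j\<le>m. monom (G j / real m ^ j) j)"
  have poly_p: "poly p u = walsh_sum I a (\<lambda>i. x i + u / real m * y i)" for u
  proof -
    have "walsh_sum I a (\<lambda>i. x i + u / real m * y i)
        = (\<Sum>T\<in>{T \<in> Pow I. card T \<le> m}.
            (u / real m) ^ card T * (walsh_sum I (partial_coeff T a) x * walsh T y))"
      unfolding walsh_sum_shift[OF I] using I vanish
      by (intro sum.mono_neutral_right) auto
    also have "\<dots> = (\<Sum>j\<le>m. \<Sum>T\<in>{T \<in> {T \<in> Pow I. card T \<le> m}. card T = j}.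
            (u / real m) ^ card T * (walsh_sum I (partial_coeff T a) x * walsh T y))"
      using I by (intro sum.group[symmetric]) auto
    also have "\<dots> = (\<Sum>j\<le>m. (u / real m) ^ j * G j)"
    proof (rule sum.cong[OF refl])
      fix j assume "j \<in> {..m}"
      then have "{T \<in> {T \<in> Pow I. card T \<le> m}. card T = j} = {T \<in> Pow I. card T = j}" by auto
      then show "(\<Sum>T\<in>{T \<in> {T \<in> Pow I. card T \<le> m}. card T = j}.
            (u / real m) ^ card T * (walsh_sum I (partial_coeff T a) x * walsh T y)) = (u / real m) ^ j * G j"
        by (simp add: G_def sum_distrib_left)
    qed
    also have "\<dots> = poly p u"
      by (simp add: p_def poly_sum poly_monom power_divide mult_ac)
    finally show ?thesis ..
  qed
  have p_bound: "\<bar>poly p u\<bar> \<le> 3 * B" if u: "\<bar>u\<bar> \<le> 1" for u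
  proof -
    define c where "c = 1 + 1 / real m"
    \<comment> \<open>The point of the line, scaled back into the solid cube.\<close>
    define z where "z i = (x i + u / real m * y i) / c" for i
    have c: "c > 0" by (simp add: c_def add_pos_nonneg)
    have "\<bar>walsh_sum I a z\<bar> \<le> B"
    proof (rule walsh_sum_bound_solid_cube[OF I bound])
      fix i assume i: "i \<in> I"
      have "\<bar>x i + u / real m * y i\<bar> \<le> \<bar>x i\<bar> + \<bar>u / real m * y i\<bar>" by (rule abs_triangle_ineq)
      also have "\<dots> \<le> c"
        using sign_cube_values[OF x i] sign_cube_values[OF y i] u m
        by (auto simp: c_def abs_mult divide_right_mono)
      finally show "\<bar>z i\<bar> \<le> 1" using c by (simp add: z_def)
    qed
    moreover have "walsh_sum I a (\<lambda>i. x i + u / real m * y i) = c ^ m * walsh_sum I a z"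
    proof -
      have scale: "a S * walsh S (\<lambda>i. x i + u / real m * y i) = c ^ m * (a S * walsh S z)"
        if S: "S \<subseteq> I" for S
      proof (cases "card S = m")
        case True
        have "walsh S (\<lambda>i. x i + u / real m * y i) = (\<Prod>i\<in>S. c * z i)"
          unfolding walsh_def z_def using c by (intro prod.cong) auto
        then show ?thesis using True by (simp add: walsh_def prod.distrib)
      qed (simp add: hom S)
      have "(\<Sum>S\<in>Pow I. a S * walsh S (\<lambda>i. x i + u / real m * y i))
          = (\<Sum>S\<in>Pow I. c ^ m * (a S * walsh S z))"
        by (rule sum.cong[OF refl]) (rule scale, rule PowD)
      then show ?thesis by (simp only: walsh_sum_def sum_distrib_left)
    qed
    moreover have "c ^ m \<le> 3"
    proof -
      have "c ^ m \<le> exp (1 / real m) ^ m"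
        unfolding c_def by (intro power_mono) auto
      also have "\<dots> = exp 1" using m by (simp flip: exp_of_nat_mult)
      also have "\<dots> \<le> 3" by (rule exp_le)
      finally show ?thesis .
    qed
    ultimately have "\<bar>poly p u\<bar> = c ^ m * \<bar>walsh_sum I a z\<bar>" "c ^ m \<le> 3" "\<bar>walsh_sum I a z\<bar> \<le> B"
      unfolding poly_p using c by (simp_all only: abs_mult power_abs abs_of_pos)
    then show ?thesis using c by (simp add: mult_mono)
  qed
  show ?thesis
  proof (cases "j \<le> m")
    case True
    have deg: "degree p \<le> m"
      by (rule degree_le) (simp add: p_def coeff_sum)
    have "coeff p j = G j / real m ^ j"
      using True by (simp add: p_def coeff_sum)
    then have "\<bar>G j\<bar> = real m ^ j * \<bar>coeff p j\<bar>" using m by (simp add: abs_divide)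
    also have "\<dots> \<le> real m ^ j * (2 * real (m + 1) * real m ^ j * (3 * B))"
      by (intro mult_left_mono abs_coeff_le_of_bounded deg p_bound) auto
    also have "\<dots> = real (m + 1) * (6 * real m ^ (2 * j) * B)"
      by (simp add: power_even_eq power2_eq_square)
    also have "\<dots> \<le> (2 * real m) * (6 * real m ^ (2 * j) * B)"
      using m B by (intro mult_right_mono) auto
    finally show ?thesis by (simp add: G_def)
  next
    case False
    then have "G j = 0" unfolding G_def using vanish by (intro sum.neutral) auto
    then show ?thesis using B by (simp add: G_def)
  qed
qed

section \<open>A Bohnenblust-Hille inequality\<close>

text \<open>
  The inequality of arithmetic and geometric means for the \<open>k\<close> numbers \<open>b\<^sup>2 / r i\<close> together with
  \<open>\<Prod>i\<in>T. r i\<close>: the weights cancel in the product, which is \<open>b ^ (2 * k)\<close>.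
\<close>

lemma powr_le_mean_of_weights:
  fixes r :: "'i \<Rightarrow> real"
  assumes T: "finite T" "card T = k" and r: "\<And>i. i \<in> T \<Longrightarrow> 0 \<le> r i"
    and dom: "\<And>i. i \<in> T \<Longrightarrow> b \<noteq> 0 \<Longrightarrow> r i \<noteq> 0"
  shows "\<bar>b\<bar> powr (2 * real k / (real k + 1)) \<le> ((\<Sum>i\<in>T. b\<^sup>2 / r i) + (\<Prod>i\<in>T. r i)) / (real k + 1)"
proof (cases "b = 0")
  case True
  then show ?thesis using r by (simp add: prod_nonneg)
next
  case False
  \<comment> \<open>The index \<open>None\<close> carries the extra term of the mean.\<close>
  define t where "t j = (case j of None \<Rightarrow> \<Prod>i\<in>T. r i | Some i \<Rightarrow> b\<^sup>2 / r i)" for j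
  define J where "J = insert None (Some ` T)"
  have J: "finite J" "J \<noteq> {}" "card J = k + 1"
    using T by (auto simp: J_def card_image)
  have inj: "inj_on Some T" by simp
  have "(\<Prod>j\<in>J. t j) = (\<Prod>i\<in>T. r i) * (\<Prod>i\<in>T. b\<^sup>2 / r i)"
    using T by (simp add: J_def t_def prod.reindex)
  also have "\<dots> = (\<Prod>i\<in>T. b\<^sup>2)"
    unfolding prod.distrib[symmetric] using dom False by (intro prod.cong) auto
  also have "\<dots> = \<bar>b\<bar> powr (2 * real k)"
    using T False by (simp add: powr_realpow[of "\<bar>b\<bar>" "2 * k", simplified] power_mult)
  finally have P: "(\<Prod>j\<in>J. t j) = \<bar>b\<bar> powr (2 * real k)" .
  have S: "(\<Sum>j\<in>J. t j) = (\<Sum>i\<in>T. b\<^sup>2 / r i) + (\<Prod>i\<in>T. r i)"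
    using T by (simp add: J_def t_def sum.reindex)
  have "(\<Prod>j\<in>J. t j) powr (1 / real (card J)) \<le> (\<Sum>j\<in>J. t j / real (card J))"
    using r by (intro arith_geom_mean J) (auto simp: J_def t_def prod_nonneg)
  then show ?thesis
    unfolding P sum_divide_distrib[symmetric] S J(3) by (simp add: powr_powr add.commute)
qed

text \<open>
  The combinatorial half of the Bohnenblust-Hille inequality: a mixed \<open>(1, 2)\<close>-norm controls the
  norm with exponent \<open>2 * k / (k + 1)\<close>. The pointwise bound is summed over \<open>T\<close>, with \<open>r i\<close> the
  \<open>l\<^sup>2\<close>-norm of the coefficients of the sets through \<open>i\<close>. Exchanging the order of summation turns
  the terms \<open>(b T)\<^sup>2 / r i\<close> into \<open>(r i)\<^sup>2 / r i = r i\<close>, and the products sum to at most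
  \<open>\<Prod>i. (1 + r i) \<le> exp 1\<close>.
\<close>

lemma sum_powr_le_of_mixed_norm_le_1:
  fixes b :: "'i set \<Rightarrow> real"
  assumes I: "finite I" and k: "k \<ge> 1"
    and mixed: "(\<Sum>i\<in>I. sqrt (\<Sum>T\<in>{T \<in> Pow I. card T = k \<and> i \<in> T}. (b T)\<^sup>2)) \<le> 1"
  shows "(\<Sum>T\<in>{T \<in> Pow I. card T = k}. \<bar>b T\<bar> powr (2 * real k / (real k + 1))) \<le> 2"
proof -
  define r where "r i = sqrt (\<Sum>T\<in>{T \<in> Pow I. card T = k \<and> i \<in> T}. (b T)\<^sup>2)" for i
  have r0: "r i \<ge> 0" for i unfolding r_def by (simp add: sum_nonneg)
  have r2: "(r i)\<^sup>2 = (\<Sum>T\<in>{T \<in> Pow I. card T = k \<and> i \<in> T}. (b T)\<^sup>2)" for i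
    unfolding r_def by (simp add: sum_nonneg)
  have fin: "finite {T \<in> Pow I. P T}" for P using I by simp
  have pointwise: "\<bar>b T\<bar> powr (2 * real k / (real k + 1))
      \<le> ((\<Sum>i\<in>T. (b T)\<^sup>2 / r i) + (\<Prod>i\<in>T. r i)) / (real k + 1)"
    if T: "T \<in> {T \<in> Pow I. card T = k}" for T
  proof (rule powr_le_mean_of_weights)
    show "finite T" using T I by (auto intro: finite_subset)
    show "card T = k" using T by simp
    fix i assume i: "i \<in> T"
    show "0 \<le> r i" by (rule r0)
    assume "b T \<noteq> 0"
    have "(b T)\<^sup>2 \<le> (r i)\<^sup>2"
      unfolding r2 using T i by (intro member_le_sum fin) auto
    then show "r i \<noteq> 0" using \<open>b T \<noteq> 0\<close> by auto
  qed
  have "(\<Sum>T\<in>{T \<in> Pow I. card T = k}. \<bar>b T\<bar> powr (2 * real k / (real k + 1)))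
      \<le> (\<Sum>T\<in>{T \<in> Pow I. card T = k}. ((\<Sum>i\<in>T. (b T)\<^sup>2 / r i) + (\<Prod>i\<in>T. r i)) / (real k + 1))"
    by (rule sum_mono) (rule pointwise)
  also have "\<dots> = ((\<Sum>T\<in>{T \<in> Pow I. card T = k}. \<Sum>i\<in>T. (b T)\<^sup>2 / r i)
      + (\<Sum>T\<in>{T \<in> Pow I. card T = k}. \<Prod>i\<in>T. r i)) / (real k + 1)"
    by (simp only: sum_divide_distrib[symmetric] sum.distrib)
  also have "\<dots> \<le> (1 + 3) / (real k + 1)"
  proof (intro divide_right_mono add_mono)
    have "(\<Sum>T\<in>{T \<in> Pow I. card T = k}. \<Sum>i\<in>T. (b T)\<^sup>2 / r i)
        = (\<Sum>T\<in>{T \<in> Pow I. card T = k}. \<Sum>i\<in>{i \<in> I. i \<in> T}. (b T)\<^sup>2 / r i)"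
      by (intro sum.cong) auto
    also have "\<dots> = (\<Sum>i\<in>I. \<Sum>T\<in>{T \<in> {T \<in> Pow I. card T = k}. i \<in> T}. (b T)\<^sup>2 / r i)"
      by (rule sum.swap_restrict) (use I in auto)
    also have "\<dots> = (\<Sum>i\<in>I. r i)"
    proof (rule sum.cong[OF refl])
      fix i
      have "{T \<in> {T \<in> Pow I. card T = k}. i \<in> T} = {T \<in> Pow I. card T = k \<and> i \<in> T}" by auto
      then have "(\<Sum>T\<in>{T \<in> {T \<in> Pow I. card T = k}. i \<in> T}. (b T)\<^sup>2 / r i) = (r i)\<^sup>2 / r i"
        by (simp only: r2 sum_divide_distrib)
      then show "(\<Sum>T\<in>{T \<in> {T \<in> Pow I. card T = k}. i \<in> T}. (b T)\<^sup>2 / r i) = r i"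
        by (simp add: power2_eq_square)
    qed
    finally show "(\<Sum>T\<in>{T \<in> Pow I. card T = k}. \<Sum>i\<in>T. (b T)\<^sup>2 / r i) \<le> 1"
      using mixed by (simp add: r_def)
    have "(\<Sum>T\<in>{T \<in> Pow I. card T = k}. \<Prod>i\<in>T. r i) \<le> (\<Sum>T\<in>Pow I. \<Prod>i\<in>T. r i)"
      using I r0 by (intro sum_mono2) (auto simp: prod_nonneg)
    also have "\<dots> = (\<Prod>i\<in>I. r i + 1)" using prod_add[OF I, of r "\<lambda>_. 1"] by simp
    also have "\<dots> \<le> (\<Prod>i\<in>I. exp (r i))" using r0 by (intro prod_mono) (auto simp: add.commute add_nonneg_nonneg)
    also have "\<dots> = exp (\<Sum>i\<in>I. r i)" using I by (simp add: exp_sum)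
    also have "\<dots> \<le> exp 1" using mixed by (simp add: r_def)
    also have "\<dots> \<le> 3" by (rule exp_le)
    finally show "(\<Sum>T\<in>{T \<in> Pow I. card T = k}. \<Prod>i\<in>T. r i) \<le> 3" .
  qed simp
  also have "\<dots> \<le> 2" using k by (simp add: field_simps)
  finally show ?thesis .
qed

lemma sum_powr_le_of_mixed_norm_le:
  fixes b :: "'i set \<Rightarrow> real"
  assumes I: "finite I" and k: "k \<ge> 1" and A: "A \<ge> 0"
    and mixed: "(\<Sum>i\<in>I. sqrt (\<Sum>T\<in>{T \<in> Pow I. card T = k \<and> i \<in> T}. (b T)\<^sup>2)) \<le> A"
    and p: "p = 2 * real k / (real k + 1)"
  shows "(\<Sum>T\<in>{T \<in> Pow I. card T = k}. \<bar>b T\<bar> powr p) \<le> 2 * A powr p"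
proof (cases "A = 0")
  case True
  have "b T = 0" if T: "T \<in> {T \<in> Pow I. card T = k}" for T
  proof -
    have "T \<noteq> {}" using T k by auto
    then obtain i where i: "i \<in> T" by blast
    have "(\<Sum>i\<in>I. sqrt (\<Sum>T\<in>{T \<in> Pow I. card T = k \<and> i \<in> T}. (b T)\<^sup>2)) = 0"
      using mixed unfolding True by (intro antisym sum_nonneg real_sqrt_ge_zero) auto
    then have "(\<Sum>T\<in>{T \<in> Pow I. card T = k \<and> i \<in> T}. (b T)\<^sup>2) = 0"
      using I T i sum_nonneg_eq_0_iff[OF I, of "\<lambda>i. sqrt (\<Sum>T\<in>{T \<in> Pow I. card T = k \<and> i \<in> T}. (b T)\<^sup>2)"]
      by (simp add: sum_nonneg subset_iff)
    moreover have "(b T)\<^sup>2 \<le> (\<Sum>T\<in>{T \<in> Pow I. card T = k \<and> i \<in> T}. (b T)\<^sup>2)"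
      using I T i by (intro member_le_sum) auto
    ultimately show ?thesis by simp
  qed
  then show ?thesis by simp
next
  case False
  then have A: "A > 0" using A by simp
  have "(\<Sum>i\<in>I. sqrt (\<Sum>T\<in>{T \<in> Pow I. card T = k \<and> i \<in> T}. (b T / A)\<^sup>2))
      = (\<Sum>i\<in>I. sqrt (\<Sum>T\<in>{T \<in> Pow I. card T = k \<and> i \<in> T}. (b T)\<^sup>2)) / A"
    using A by (simp add: power_divide sum_divide_distrib[symmetric] real_sqrt_divide)
  also have "\<dots> \<le> 1" using mixed A by simp
  finally have "(\<Sum>T\<in>{T \<in> Pow I. card T = k}. \<bar>b T / A\<bar> powr p) \<le> 2"
    unfolding p by (rule sum_powr_le_of_mixed_norm_le_1[OF I k])
  also have "(\<Sum>T\<in>{T \<in> Pow I. card T = k}. \<bar>b T / A\<bar> powr p)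
      = (\<Sum>T\<in>{T \<in> Pow I. card T = k}. \<bar>b T\<bar> powr p) / A powr p"
    using A by (simp add: abs_divide powr_divide sum_divide_distrib)
  finally show ?thesis using A by (simp add: field_simps)
qed

lemma sum_card_eq_1:
  fixes g :: "'i set \<Rightarrow> real"
  shows "(\<Sum>T\<in>{T \<in> Pow I. card T = 1}. g T) = (\<Sum>i\<in>I. g {i})"
proof -
  have "{T \<in> Pow I. card T = 1} = (\<lambda>i. {i}) ` I" by (auto simp: card_Suc_eq)
  then show ?thesis by (simp add: sum.reindex inj_on_def)
qed

text \<open>
  The analytic half of the Bohnenblust-Hille inequality. The inner \<open>l\<^sup>2\<close>-norm is the \<open>L\<^sup>2\<close>-norm of the
  derivative in direction \<open>i\<close>, which is comparable to its \<open>L\<^sup>1\<close>-norm. Summed over \<open>i\<close>, the absolute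
  values of the derivatives at a point \<open>x\<close> are the derivative of the function in a suitable
  direction \<open>y\<close> of the cube, and polarization applies.
\<close>

lemma mixed_norm_le_sup_norm:
  assumes I: "finite I" and hom: "\<And>S. S \<subseteq> I \<Longrightarrow> card S \<noteq> k \<Longrightarrow> b S = 0" and k: "k \<ge> 1"
    and bound: "\<And>x. x \<in> sign_cube I \<Longrightarrow> \<bar>walsh_sum I b x\<bar> \<le> B"
  shows "(\<Sum>i\<in>I. sqrt (\<Sum>T\<in>{T \<in> Pow I. card T = k \<and> i \<in> T}. (b T)\<^sup>2))
       \<le> 3 ^ k * (12 * real k ^ 3 * B)"
proof -
  define D where "D i x = walsh_sum I (partial_coeff {i} b) x" for i x
  have B: "B \<ge> 0"
  proof -
    obtain x where "x \<in> sign_cube I" using sign_cube_nonempty by blast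
    then show ?thesis using bound[of x] by simp
  qed
  have "sqrt (\<Sum>T\<in>{T \<in> Pow I. card T = k \<and> i \<in> T}. (b T)\<^sup>2) \<le> 3 ^ k * mean I (\<lambda>x. \<bar>D i x\<bar>)"
    if i: "i \<in> I" for i
  proof -
    have "(\<Sum>T\<in>{T \<in> Pow I. card T = k \<and> i \<in> T}. (b T)\<^sup>2) = (\<Sum>S\<in>{S \<in> Pow I. {i} \<subseteq> S}. (b S)\<^sup>2)"
      using I hom by (intro sum.mono_neutral_left) auto
    also have "\<dots> = mean I (\<lambda>x. (D i x)\<^sup>2)"
      unfolding D_def using I i by (simp add: mean_square_partial)
    finally have "sqrt (\<Sum>T\<in>{T \<in> Pow I. card T = k \<and> i \<in> T}. (b T)\<^sup>2) = sqrt (mean I (\<lambda>x. (D i x)\<^sup>2))"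
      by simp
    also have "\<dots> \<le> 3 powr (real k / real 1) * (mean I (\<lambda>x. \<bar>D i x\<bar> powr 1)) powr (1 / 1)"
      unfolding D_def
    proof (rule l2_norm_le_lp_norm[OF I])
      fix R assume R: "R \<subseteq> I" "k < card R"
      show "partial_coeff {i} b R = 0"
        by (rule partial_homogeneous[OF I _ hom R(1)]) (use i R in auto)
    qed auto
    finally show ?thesis by (simp add: powr_realpow mean_nonneg)
  qed
  then have "(\<Sum>i\<in>I. sqrt (\<Sum>T\<in>{T \<in> Pow I. card T = k \<and> i \<in> T}. (b T)\<^sup>2))
      \<le> (\<Sum>i\<in>I. 3 ^ k * mean I (\<lambda>x. \<bar>D i x\<bar>))" by (rule sum_mono)
  also have "\<dots> = 3 ^ k * mean I (\<lambda>x. \<Sum>i\<in>I. \<bar>D i x\<bar>)"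
    by (simp add: mean_sum sum_distrib_left)
  also have "\<dots> \<le> 3 ^ k * (12 * real k ^ 3 * B)"
  proof (intro mult_left_mono mean_le_const I)
    fix x assume x: "x \<in> sign_cube I"
    define y where "y = restrict (\<lambda>i. if D i x \<ge> 0 then 1 else (-1::real)) I"
    have y: "y \<in> sign_cube I" by (auto simp: y_def sign_cube_def)
    have "(\<Sum>i\<in>I. \<bar>D i x\<bar>) = (\<Sum>i\<in>I. D i x * walsh {i} y)"
      by (intro sum.cong) (auto simp: y_def walsh_def)
    also have "\<dots> = (\<Sum>T\<in>{T \<in> Pow I. card T = 1}. walsh_sum I (partial_coeff T b) x * walsh T y)"
      unfolding sum_card_eq_1 D_def ..
    also have "\<dots> \<le> 12 * real k ^ (2 * 1 + 1) * B"
      using polarization_bound[OF I hom k bound x y, of 1] by linarith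
    finally show "(\<Sum>i\<in>I. \<bar>D i x\<bar>) \<le> 12 * real k ^ 3 * B" by (simp add: numeral_3_eq_3)
  qed simp
  finally show ?thesis .
qed

section \<open>The sum of the coefficients of a homogeneous function\<close>

text \<open>
  This is \<open>(N / k) ^ k \<le> N choose k\<close>, raised to the power \<open>1 / (2 * k)\<close>. It is the source of the
  gain \<open>1 / sqrt N\<close> over the trivial bound by Cauchy-Schwarz.
\<close>

lemma binomial_powr_le:
  fixes N k :: nat
  assumes "1 \<le> k" "k \<le> N"
  shows "real (N choose k) powr ((real k - 1) / (2 * real k))
       \<le> sqrt (real (N choose k)) * sqrt (real k / real N)"
proof -
  define n where "n = real (N choose k)"
  have n: "n > 0" using assms by (simp add: n_def)
  have "sqrt (real N / real k) = ((real N / real k) ^ k) powr (1 / (2 * real k))"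
    using assms by (simp add: powr_realpow[symmetric] powr_powr powr_half_sqrt)
  also have "\<dots> \<le> n powr (1 / (2 * real k))"
    using binomial_ge_n_over_k_pow_k[OF assms(2), where 'a = real]
    by (intro powr_mono2) (auto simp: n_def)
  finally have le: "sqrt (real N / real k) \<le> n powr (1 / (2 * real k))" .
  have "n powr ((real k - 1) / (2 * real k)) * n powr (1 / (2 * real k)) = sqrt n"
    using assms n by (simp add: powr_add[symmetric] add_divide_distrib[symmetric] powr_half_sqrt)
  then have "n powr ((real k - 1) / (2 * real k)) * sqrt (real N / real k) \<le> sqrt n"
    using mult_left_mono[OF le, of "n powr ((real k - 1) / (2 * real k))"] by simp
  then have "n powr ((real k - 1) / (2 * real k)) \<le> sqrt n / sqrt (real N / real k)"
    using assms by (subst pos_le_divide_eq) auto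
  then show ?thesis by (simp add: n_def real_sqrt_divide)
qed

lemma card_supersets:
  assumes I: "finite I" and T: "T \<subseteq> I" "card T = k" and k: "k \<le> m"
  shows "card {S \<in> Pow I. T \<subseteq> S \<and> card S = m} = (card I - k) choose (m - k)"
proof -
  have fT: "finite T" using I T by (auto intro: finite_subset)
  have "card {S \<in> Pow I. T \<subseteq> S \<and> card S = m} = card {R. R \<subseteq> I - T \<and> card R = m - k}"
  proof (rule bij_betw_same_card[of "\<lambda>S. S - T"], rule bij_betw_byWitness[where f' = "\<lambda>R. R \<union> T"])
    show "(\<lambda>S. S - T) ` {S \<in> Pow I. T \<subseteq> S \<and> card S = m} \<subseteq> {R. R \<subseteq> I - T \<and> card R = m - k}"
      using T fT by (auto simp: card_Diff_subset)
    show "(\<lambda>R. R \<union> T) ` {R. R \<subseteq> I - T \<and> card R = m - k} \<subseteq> {S \<in> Pow I. T \<subseteq> S \<and> card S = m}"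
    proof (rule image_subsetI)
      fix R assume R: "R \<in> {R. R \<subseteq> I - T \<and> card R = m - k}"
      then have "finite R" using I by (auto intro: finite_subset)
      moreover have "R \<inter> T = {}" using R by auto
      ultimately have "card (R \<union> T) = m" using R T fT k by (simp add: card_Un_disjoint)
      then show "R \<union> T \<in> {S \<in> Pow I. T \<subseteq> S \<and> card S = m}" using R T by auto
    qed
  qed auto
  also have "\<dots> = (card I - k) choose (m - k)"
    using I T fT by (simp add: n_subsets card_Diff_subset)
  finally show ?thesis .
qed

text \<open>
  Passing from \<open>L\<^sup>2\<close> to \<open>L\<^sup>p\<close> makes it possible to exchange the sum over \<open>T\<close> with the mean over the
  cube, so that a bound at every single point suffices.
\<close>

lemma sum_l2_norm_partial_le:
  assumes I: "finite I" and hom: "\<And>S. S \<subseteq> I \<Longrightarrow> card S \<noteq> m \<Longrightarrow> a S = 0"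
    and k: "2 \<le> k" and A: "A \<ge> 0"
    and bound: "\<And>x. x \<in> sign_cube I \<Longrightarrow>
      (\<Sum>T\<in>{T \<in> Pow I. card T = k}. \<bar>walsh_sum I (partial_coeff T a) x\<bar> powr (2 * real k / (real k + 1)))
      \<le> 2 * A powr (2 * real k / (real k + 1))"
  shows "(\<Sum>T\<in>{T \<in> Pow I. card T = k}. sqrt (mean I (\<lambda>x. (walsh_sum I (partial_coeff T a) x)\<^sup>2)))
       \<le> 3 powr (real m / real k) * (2 * A * real (card I choose k) powr ((real k - 1) / (2 * real k)))"
proof -
  define p where "p = 2 * real k / (real k + 1)"
  define \<beta> where "\<beta> = (real k - 1) / (2 * real k)"
  define M where "M T = mean I (\<lambda>x. \<bar>walsh_sum I (partial_coeff T a) x\<bar> powr p)" for T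
  define L where "L = {T \<in> Pow I. card T = k}"
  have L: "finite L" "card L = card I choose k"
    using I by (simp_all add: L_def n_subsets)
  have p: "p \<ge> 1" using k by (simp add: p_def field_simps)
  have w: "0 < 1 / p" "0 < \<beta>" "1 / p + \<beta> = 1"
    using k p by (auto simp: p_def \<beta>_def field_simps)
  have M0: "M T \<ge> 0" for T unfolding M_def by (intro mean_nonneg) simp
  have "(\<Sum>T\<in>L. sqrt (mean I (\<lambda>x. (walsh_sum I (partial_coeff T a) x)\<^sup>2)))
      \<le> (\<Sum>T\<in>L. 3 powr (real m / real k) * M T powr (1 / p))"
  proof (rule sum_mono)
    fix T assume T: "T \<in> L"
    show "sqrt (mean I (\<lambda>x. (walsh_sum I (partial_coeff T a) x)\<^sup>2))
        \<le> 3 powr (real m / real k) * M T powr (1 / p)"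
      unfolding M_def
    proof (rule l2_norm_le_lp_norm[OF I _ _ p_def])
      fix R assume R: "R \<subseteq> I" "m < card R"
      show "partial_coeff T a R = 0"
        by (rule partial_homogeneous[OF I _ hom R(1)]) (use T R in \<open>auto simp: L_def\<close>)
    qed (use k in simp)
  qed
  also have "\<dots> = 3 powr (real m / real k) * (\<Sum>T\<in>L. M T powr (1 / p) * 1 powr \<beta>)"
    by (simp add: sum_distrib_left)
  also have "\<dots> \<le> 3 powr (real m / real k) * ((\<Sum>T\<in>L. M T) powr (1 / p) * (\<Sum>T\<in>L. 1) powr \<beta>)"
    by (intro mult_left_mono holder_sum w L M0) auto
  also have "\<dots> \<le> 3 powr (real m / real k) * ((2 * A) * real (card I choose k) powr \<beta>)"
  proof (intro mult_left_mono mult_mono)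
    have "(\<Sum>T\<in>L. M T) = mean I (\<lambda>x. \<Sum>T\<in>L. \<bar>walsh_sum I (partial_coeff T a) x\<bar> powr p)"
      by (simp add: M_def mean_sum)
    also have "\<dots> \<le> 2 * A powr p"
      using bound by (intro mean_le_const I) (simp add: L_def p_def)
    finally have "(\<Sum>T\<in>L. M T) powr (1 / p) \<le> (2 * A powr p) powr (1 / p)"
      using M0 w by (intro powr_mono2) (auto simp: sum_nonneg)
    also have "\<dots> = 2 powr (1 / p) * A"
      using A p by (simp add: powr_mult powr_powr)
    also have "\<dots> \<le> 2 powr 1 * A"
      using p A by (intro mult_right_mono powr_mono) auto
    finally show "(\<Sum>T\<in>L. M T) powr (1 / p) \<le> 2 * A" by simp
  qed (use A L in auto)
  finally show ?thesis by (simp add: L_def \<beta>_def)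
qed

text \<open>
  Every set \<open>S\<close> of size \<open>m\<close> contains \<open>m choose k\<close> sets \<open>T\<close> of size \<open>k\<close>. Charging \<open>\<bar>a S\<bar>\<close> to these sets
  and applying Cauchy-Schwarz to the sets \<open>S\<close> above a fixed \<open>T\<close> leads to the \<open>L\<^sup>2\<close>-norms of the
  derivatives of order \<open>k\<close>. Their values at a fixed point \<open>x\<close> are the coefficients of a
  \<open>k\<close>-homogeneous function of \<open>y\<close> which is bounded by polarization, so the Bohnenblust-Hille
  inequality of degree \<open>k\<close> applies at each \<open>x\<close>.
\<close>

theorem sum_abs_coeff_le_level:
  assumes I: "finite I" and hom: "\<And>S. S \<subseteq> I \<Longrightarrow> card S \<noteq> m \<Longrightarrow> a S = 0"
    and k: "2 \<le> k" "k \<le> m" and m: "m \<le> card I"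
    and bound: "\<And>x. x \<in> sign_cube I \<Longrightarrow> \<bar>walsh_sum I a x\<bar> \<le> B"
  shows "(\<Sum>S\<in>Pow I. \<bar>a S\<bar>)
       \<le> 288 * 3 powr (real m / real k) * 3 ^ k * real k ^ 3 * real m ^ (2 * k + 1) * sqrt (real k)
         * (sqrt (real (card I choose m) / real (card I)) * B)"
proof -
  define N where "N = card I"
  define p where "p = 2 * real k / (real k + 1)"
  define A where "A = 3 ^ k * (12 * real k ^ 3 * (12 * real m ^ (2 * k + 1) * B))"
  define L where "L = {T \<in> Pow I. card T = k}"
  define D where "D T x = walsh_sum I (partial_coeff T a) x" for T x
  have B: "B \<ge> 0"
  proof -
    obtain x where "x \<in> sign_cube I" using sign_cube_nonempty by blast
    then show ?thesis using bound[of x] by simp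
  qed
  then have A: "A \<ge> 0" by (simp add: A_def)
  have L: "finite L" using I by (simp add: L_def)
  have level: "(\<Sum>T\<in>L. \<bar>D T x\<bar> powr p) \<le> 2 * A powr p" if x: "x \<in> sign_cube I" for x
  proof -
    \<comment> \<open>The coefficients, as a function of \<open>y\<close>, of the part of degree \<open>k\<close> of the Taylor expansion at \<open>x\<close>.\<close>
    define b where "b T = (if card T = k then D T x else 0)" for T
    have m1: "1 \<le> m" using k by simp
    have b_bound: "\<bar>walsh_sum I b y\<bar> \<le> 12 * real m ^ (2 * k + 1) * B" if y: "y \<in> sign_cube I" for y
    proof -
      have "walsh_sum I b y = (\<Sum>T\<in>{T \<in> Pow I. card T = k}. D T x * walsh T y)"
        unfolding walsh_sum_def using I by (intro sum.mono_neutral_cong_right) (auto simp: b_def)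
      then show ?thesis
        using polarization_bound[OF I hom m1 bound x y, of k] by (simp add: D_def)
    qed
    have "(\<Sum>i\<in>I. sqrt (\<Sum>T\<in>{T \<in> Pow I. card T = k \<and> i \<in> T}. (b T)\<^sup>2)) \<le> A"
      unfolding A_def by (rule mixed_norm_le_sup_norm[OF I _ _ b_bound]) (use k in \<open>auto simp: b_def\<close>)
    then have "(\<Sum>T\<in>{T \<in> Pow I. card T = k}. \<bar>b T\<bar> powr p) \<le> 2 * A powr p"
      using k A by (intro sum_powr_le_of_mixed_norm_le I p_def) auto
    then show ?thesis by (simp add: b_def L_def)
  qed
  have "real (m choose k) * (\<Sum>S\<in>Pow I. \<bar>a S\<bar>) = (\<Sum>S\<in>Pow I. \<Sum>T\<in>{T \<in> L. T \<subseteq> S}. \<bar>a S\<bar>)"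
    unfolding sum_distrib_left
  proof (rule sum.cong[OF refl])
    fix S assume S: "S \<in> Pow I"
    show "real (m choose k) * \<bar>a S\<bar> = (\<Sum>T\<in>{T \<in> L. T \<subseteq> S}. \<bar>a S\<bar>)"
    proof (cases "card S = m")
      case True
      have "{T \<in> L. T \<subseteq> S} = {T. T \<subseteq> S \<and> card T = k}" using S by (auto simp: L_def)
      then show ?thesis using S I True by (simp add: n_subsets finite_subset)
    qed (use S hom in auto)
  qed
  also have "\<dots> = (\<Sum>T\<in>L. \<Sum>S\<in>{S \<in> Pow I. T \<subseteq> S}. \<bar>a S\<bar>)"
    by (rule sum.swap_restrict) (use I L in auto)
  also have "\<dots> \<le> (\<Sum>T\<in>L. sqrt (real ((N - k) choose (m - k))) * sqrt (mean I (\<lambda>x. (D T x)\<^sup>2)))"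
  proof (rule sum_mono)
    fix T assume T: "T \<in> L"
    define U where "U = {S \<in> Pow I. T \<subseteq> S \<and> card S = m}"
    have "(\<Sum>S\<in>{S \<in> Pow I. T \<subseteq> S}. \<bar>a S\<bar>) = (\<Sum>S\<in>U. 1 * \<bar>a S\<bar>)"
      using I hom by (simp only: mult_1, intro sum.mono_neutral_right) (auto simp: U_def)
    moreover have "(\<Sum>S\<in>U. 1 * \<bar>a S\<bar>)\<^sup>2 \<le> (\<Sum>S\<in>U. 1\<^sup>2) * (\<Sum>S\<in>U. \<bar>a S\<bar>\<^sup>2)"
      by (rule Cauchy_Schwarz_ineq_sum)
    moreover have "(\<Sum>S\<in>U. 1\<^sup>2) = real ((N - k) choose (m - k))"
      using card_supersets[OF I, of T k m] T k by (simp add: U_def N_def L_def)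
    moreover have "(\<Sum>S\<in>U. \<bar>a S\<bar>\<^sup>2) = mean I (\<lambda>x. (D T x)\<^sup>2)"
    proof -
      have "(\<Sum>S\<in>U. \<bar>a S\<bar>\<^sup>2) = (\<Sum>S\<in>{S \<in> Pow I. T \<subseteq> S}. (a S)\<^sup>2)"
        unfolding power2_abs using I hom by (intro sum.mono_neutral_left) (auto simp: U_def)
      then show ?thesis using T I by (simp add: D_def L_def mean_square_partial)
    qed
    ultimately have "(\<Sum>S\<in>{S \<in> Pow I. T \<subseteq> S}. \<bar>a S\<bar>)\<^sup>2
        \<le> real ((N - k) choose (m - k)) * mean I (\<lambda>x. (D T x)\<^sup>2)" by simp
    then show "(\<Sum>S\<in>{S \<in> Pow I. T \<subseteq> S}. \<bar>a S\<bar>)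
        \<le> sqrt (real ((N - k) choose (m - k))) * sqrt (mean I (\<lambda>x. (D T x)\<^sup>2))"
      by (simp add: real_le_rsqrt flip: real_sqrt_mult)
  qed
  also have "\<dots> = sqrt (real ((N - k) choose (m - k))) * (\<Sum>T\<in>L. sqrt (mean I (\<lambda>x. (D T x)\<^sup>2)))"
    by (simp add: sum_distrib_left)
  also have "\<dots> \<le> sqrt (real ((N - k) choose (m - k)))
      * (3 powr (real m / real k) * (2 * A * real (N choose k) powr ((real k - 1) / (2 * real k))))"
    unfolding N_def L_def D_def
    by (intro mult_left_mono sum_l2_norm_partial_le I hom k A)
      (use level in \<open>auto simp: L_def D_def p_def\<close>)
  also have "\<dots> \<le> sqrt (real ((N - k) choose (m - k)))
      * (3 powr (real m / real k) * (2 * A * (sqrt (real (N choose k)) * sqrt (real k / real N))))"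
    using A k m by (intro mult_left_mono binomial_powr_le) (auto simp: N_def)
  also have "\<dots> = (sqrt (real ((N - k) choose (m - k))) * sqrt (real (N choose k)))
      * (3 powr (real m / real k) * (2 * A) * sqrt (real k / real N))"
    by (simp only: mult_ac)
  also have "sqrt (real ((N - k) choose (m - k))) * sqrt (real (N choose k))
      = sqrt (real (N choose m)) * sqrt (real (m choose k))"
    using choose_mult[of k m N] k m
    by (simp add: N_def real_sqrt_mult[symmetric] mult.commute flip: of_nat_mult)
  also have "\<dots> * (3 powr (real m / real k) * (2 * A) * sqrt (real k / real N))
      \<le> (sqrt (real (N choose m)) * real (m choose k)) * (3 powr (real m / real k) * (2 * A) * sqrt (real k / real N))"
  proof (intro mult_right_mono mult_left_mono)
    have "1 \<le> real (m choose k)" using k by (simp add: Suc_le_eq)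
    then have "real (m choose k) * 1 \<le> real (m choose k) * real (m choose k)"
      by (intro mult_left_mono) auto
    then show "sqrt (real (m choose k)) \<le> real (m choose k)"
      by (intro real_le_lsqrt) (auto simp: power2_eq_square)
  qed (use A in auto)
  finally have "real (m choose k) * (\<Sum>S\<in>Pow I. \<bar>a S\<bar>)
      \<le> real (m choose k) * (sqrt (real (N choose m)) * (3 powr (real m / real k) * (2 * A) * sqrt (real k / real N)))"
    by (simp only: mult_ac)
  then have "(\<Sum>S\<in>Pow I. \<bar>a S\<bar>)
      \<le> sqrt (real (N choose m)) * (3 powr (real m / real k) * (2 * A) * sqrt (real k / real N))"
    by (rule mult_left_le_imp_le) (use k in simp)
  also have "\<dots> = 288 * 3 powr (real m / real k) * 3 ^ k * real k ^ 3 * real m ^ (2 * k + 1) * sqrt (real k)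
         * (sqrt (real (N choose m) / real N) * B)"
    by (simp add: A_def real_sqrt_divide)
  finally show ?thesis by (simp only: N_def)
qed

lemma ln_ge_half: "m \<ge> 2 \<Longrightarrow> ln (real m) \<ge> 1 / 2"
proof -
  assume "m \<ge> 2"
  have "exp (1 / 2 :: real) ^ 2 \<le> 2 ^ 2" using exp_le by (simp flip: exp_of_nat_mult)
  then have "exp (1 / 2 :: real) \<le> 2" by (rule power2_le_imp_le) simp
  also have "\<dots> \<le> real m" using \<open>m \<ge> 2\<close> by simp
  finally show ?thesis using \<open>m \<ge> 2\<close> by (subst ln_ge_iff) auto
qed

text \<open>
  The two costs of level \<open>k\<close> are \<open>3 powr (m / k)\<close>, for the passage from \<open>L\<^sup>2\<close> to \<open>L\<^sup>p\<close>, and a power of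
  \<open>m\<close> with exponent proportional to \<open>k\<close>, for polarization. They balance when \<open>m / k\<close> equals
  \<open>k * ln m\<close>; the witness rounds up the real solution \<open>sqrt (m / ln m)\<close>. Rounding up, rather than
  down, keeps \<open>k\<close> at least 2.
\<close>

lemma exists_balancing_level:
  fixes m :: nat
  assumes m: "m \<ge> 2"
  obtains k where "2 \<le> k" "k \<le> m" "real m / real k \<le> sqrt (real m * ln (real m))"
    "real k * ln (real m) \<le> 2 * sqrt (real m * ln (real m))"
proof
  define l where "l = ln (real m)"
  define s where "s = sqrt (real m / l)"
  define k where "k = nat \<lceil>s\<rceil>"
  have l: "l \<ge> 1 / 2" unfolding l_def by (rule ln_ge_half[OF m])
  have lm: "l < real m" using m ln_less_self[of "real m"] by (simp add: l_def)
  have s1: "s > 1" using l lm by (simp add: s_def)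
  have "real m / l \<le> (real m)\<^sup>2"
  proof -
    have "1 \<le> real m * l" using mult_mono[of 2 "real m" "1/2" l] m l by simp
    then have "real m * 1 \<le> real m * (real m * l)" by (intro mult_left_mono) auto
    then show ?thesis using l by (simp add: field_simps power2_eq_square)
  qed
  then have sm: "s \<le> real m" unfolding s_def using l by (intro real_le_lsqrt) auto
  have sk: "s \<le> real k" "real k \<le> s + 1" using s1 unfolding k_def by linarith+
  show "2 \<le> k" using s1 unfolding k_def by linarith
  show "k \<le> m" using sm s1 unfolding k_def by linarith
  have q1: "s * sqrt (real m * l) = real m"
  proof -
    have "real m / l * (real m * l) = (real m)\<^sup>2" using l by (simp add: power2_eq_square)
    then show ?thesis unfolding s_def real_sqrt_mult[symmetric] by simp
  qed
  have q2: "s * l = sqrt (real m * l)"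
  proof -
    have "s * sqrt (l\<^sup>2) = sqrt (real m / l * l\<^sup>2)" unfolding s_def real_sqrt_mult ..
    also have "real m / l * l\<^sup>2 = real m * l" using l by (simp add: power2_eq_square)
    finally show ?thesis using l by simp
  qed
  have "real m \<le> real k * sqrt (real m * l)"
    by (subst q1[symmetric]) (use sk l in \<open>auto intro: mult_right_mono\<close>)
  then show "real m / real k \<le> sqrt (real m * ln (real m))"
    using \<open>2 \<le> k\<close> by (simp add: l_def divide_le_eq mult.commute)
  have "real k * l \<le> (2 * s) * l" using sk s1 l by (intro mult_right_mono) auto
  then show "real k * ln (real m) \<le> 2 * sqrt (real m * ln (real m))"
    using q2 by (simp add: l_def)
qed

lemma level_constant_le:
  fixes m k :: nat
  defines "q \<equiv> sqrt (real m * ln (real m))"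
  assumes m: "m \<ge> 2" and k: "2 \<le> k" "k \<le> m" "real m / real k \<le> q" "real k * ln (real m) \<le> 2 * q"
  shows "288 * 3 powr (real m / real k) * 3 ^ k * real k ^ 3 * real m ^ (2 * k + 1) * sqrt (real k)
       \<le> exp (28 * q)"
proof -
  define l where "l = ln (real m)"
  have l: "l \<ge> 1 / 2" unfolding l_def by (rule ln_ge_half[OF m])
  have lm: "l < real m" using m ln_less_self[of "real m"] by (simp add: l_def)
  have "1 \<le> real m * l" using mult_mono[of 2 "real m" "1/2" l] m l by simp
  then have q1: "q \<ge> 1" by (simp add: q_def l_def)
  have "l * l \<le> real m * l" using l lm by (intro mult_right_mono) auto
  then have lq: "l \<le> q" unfolding q_def l_def by (intro real_le_rsqrt) (simp add: power2_eq_square)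
  have e2: "(2::real) \<le> exp 1" using exp_ge_add_one_self[of "1::real"] by simp
  have ln3: "ln (3::real) \<le> 2"
  proof -
    have "(3::real) \<le> 2 ^ 2" by simp
    also have "\<dots> \<le> exp 1 ^ 2" using e2 by (intro power_mono) auto
    also have "\<dots> = exp 2" by (simp flip: exp_of_nat_mult)
    finally have "ln 3 \<le> ln (exp (2::real))" by (subst ln_le_cancel_iff) auto
    then show ?thesis by simp
  qed
  have ln288: "ln (288::real) \<le> 9"
  proof -
    have "(288::real) \<le> 2 ^ 9" by simp
    also have "\<dots> \<le> exp 1 ^ 9" using e2 by (intro power_mono) auto
    also have "\<dots> = exp 9" by (simp flip: exp_of_nat_mult)
    finally have "ln 288 \<le> ln (exp (9::real))" by (subst ln_le_cancel_iff) auto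
    then show ?thesis by simp
  qed
  have kq: "real k \<le> 4 * q"
  proof -
    have "real k * (1 / 2) \<le> real k * l" using l by (intro mult_left_mono) auto
    then show ?thesis using k(4) unfolding l_def by linarith
  qed
  have lnk: "0 \<le> ln (real k)" "ln (real k) \<le> l" using k by (simp_all add: l_def)
  have "ln (288 * 3 powr (real m / real k) * 3 ^ k * real k ^ 3 * real m ^ (2 * k + 1) * sqrt (real k))
      = ln 288 + real m / real k * ln 3 + real k * ln 3 + 3 * ln (real k) + (2 * real k + 1) * l + ln (real k) / 2"
    using k m by (simp add: ln_mult ln_powr ln_realpow ln_sqrt l_def algebra_simps)
  also have "\<dots> \<le> 9 + q * 2 + (4 * q) * 2 + 3 * q + (4 * q + q) + q"
  proof (intro add_mono)
    show "real m / real k * ln 3 \<le> q * 2" using k ln3 q1 by (intro mult_mono) auto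
    show "real k * ln 3 \<le> 4 * q * 2" using kq ln3 q1 by (intro mult_mono) auto
    show "(2 * real k + 1) * l \<le> 4 * q + q" using k(4) lq by (simp add: l_def algebra_simps)
  qed (use ln288 lnk lq q1 in auto)
  also have "\<dots> \<le> 28 * q" using q1 by simp
  finally have "exp (ln (288 * 3 powr (real m / real k) * 3 ^ k * real k ^ 3 * real m ^ (2 * k + 1) * sqrt (real k)))
      \<le> exp (28 * q)" by simp
  then show ?thesis using k m by simp
qed

text \<open>
  For \<open>m = 1\<close> the constant is 1: a linear function attains the sum of the absolute values of its
  coefficients at the point given by their signs. All other degrees use the balancing level.
\<close>

theorem sum_abs_coeff_le_sup_norm:
  assumes I: "finite I" and hom: "\<And>S. S \<subseteq> I \<Longrightarrow> card S \<noteq> m \<Longrightarrow> a S = 0"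
    and m: "1 \<le> m" "m \<le> card I"
    and bound: "\<And>x. x \<in> sign_cube I \<Longrightarrow> \<bar>walsh_sum I a x\<bar> \<le> B"
  shows "(\<Sum>S\<in>Pow I. \<bar>a S\<bar>)
       \<le> exp (28 * sqrt (real m * ln (real m))) * (sqrt (real (card I choose m) / real (card I)) * B)"
proof (cases "m = 1")
  case True
  define x where "x = restrict (\<lambda>i. if a {i} \<ge> 0 then 1 else (-1::real)) I"
  have x: "x \<in> sign_cube I" by (auto simp: x_def sign_cube_def)
  have level_1: "(\<Sum>S\<in>Pow I. g S) = (\<Sum>i\<in>I. g {i})" if "\<And>S. a S = 0 \<Longrightarrow> g S = 0" for g :: "nat set \<Rightarrow> real"
  proof -
    have "(\<Sum>S\<in>Pow I. g S) = (\<Sum>S\<in>{S \<in> Pow I. card S = 1}. g S)"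
      using I that hom True by (intro sum.mono_neutral_right) auto
    then show ?thesis by (simp only: sum_card_eq_1)
  qed
  have "(\<Sum>S\<in>Pow I. \<bar>a S\<bar>) = (\<Sum>i\<in>I. \<bar>a {i}\<bar>)" by (rule level_1) simp
  also have "\<dots> = (\<Sum>i\<in>I. a {i} * walsh {i} x)" by (intro sum.cong) (auto simp: x_def walsh_def)
  also have "\<dots> = walsh_sum I a x" unfolding walsh_sum_def by (rule level_1[symmetric]) simp
  also have "\<dots> \<le> B" using bound[OF x] by simp
  finally show ?thesis using True m by simp
next
  case False
  then have m2: "m \<ge> 2" using m by simp
  obtain k where k: "2 \<le> k" "k \<le> m" "real m / real k \<le> sqrt (real m * ln (real m))"
    "real k * ln (real m) \<le> 2 * sqrt (real m * ln (real m))"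
    using exists_balancing_level[OF m2] by blast
  have B: "B \<ge> 0"
  proof -
    obtain x where "x \<in> sign_cube I" using sign_cube_nonempty by blast
    then show ?thesis using bound[of x] by simp
  qed
  show ?thesis
    using sum_abs_coeff_le_level[OF I hom k(1,2) m(2) bound]
      mult_right_mono[OF level_constant_le[OF m2 k], of "sqrt (real (card I choose m) / real (card I)) * B"] B
    by simp
qed

section \<open>Homogeneous functions with small maximum\<close>

lemma cosh_le_exp_square: "(exp t + exp (- t)) / 2 \<le> exp (t\<^sup>2)" for t :: real
proof -
  have nonneg: "(exp s + exp (- s)) / 2 \<le> exp (s\<^sup>2)" if s: "s \<ge> 0" for s :: real
  proof (cases "s \<le> 1")
    case True
    have upper: "exp s \<le> 1 + s + s\<^sup>2" using s True by (rule exp_bound)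
    have lower: "exp (- s) \<le> 1 - s + s\<^sup>2"
    proof -
      \<comment> \<open>The product equals \<open>1 + s ^ 3\<close>.\<close>
      have "1 \<le> (1 - s + s\<^sup>2) * (1 + s)"
        using s by (simp add: algebra_simps power2_eq_square)
      also have "\<dots> \<le> (1 - s + s\<^sup>2) * exp s"
        using True by (intro mult_left_mono exp_ge_add_one_self) auto
      finally show ?thesis by (simp add: exp_minus field_simps)
    qed
    have "(exp s + exp (- s)) / 2 \<le> ((1 + s + s\<^sup>2) + (1 - s + s\<^sup>2)) / 2"
      by (intro divide_right_mono add_mono upper lower) simp
    also have "\<dots> = 1 + s\<^sup>2" by simp
    also have "\<dots> \<le> exp (s\<^sup>2)" by (rule exp_ge_add_one_self)
    finally show ?thesis .
  next
    case False
    then have "s * 1 \<le> s * s" by (intro mult_left_mono) auto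
    then have "exp s \<le> exp (s\<^sup>2)" "exp (- s) \<le> exp (s\<^sup>2)"
      using s by (simp_all add: power2_eq_square)
    then have "exp s + exp (- s) \<le> exp (s\<^sup>2) + exp (s\<^sup>2)" by (rule add_mono)
    then show ?thesis by (simp only: mult_2[symmetric]) (simp add: divide_le_eq mult.commute)
  qed
  show ?thesis
    using nonneg[of t] nonneg[of "- t"] by (cases "t \<ge> 0") (simp_all add: add.commute)
qed

text \<open>
  The moment generating function of a sum of independent signs factors, and each factor is a
  hyperbolic cosine.
\<close>

lemma mean_exp_rademacher_le:
  fixes w :: "'i \<Rightarrow> real"
  assumes I: "finite I" and w: "\<And>i. i \<in> I \<Longrightarrow> \<bar>w i\<bar> = 1"
  shows "mean I (\<lambda>e. exp (t * (\<Sum>i\<in>I. e i * w i))) \<le> exp (t\<^sup>2 * real (card I))"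
proof -
  have "mean I (\<lambda>e. exp (t * (\<Sum>i\<in>I. e i * w i))) = mean I (\<lambda>e. \<Prod>i\<in>I. exp (t * (e i * w i)))"
    using I by (simp add: exp_sum sum_distrib_left)
  also have "\<dots> = (\<Prod>i\<in>I. (exp (t * w i) + exp (- (t * w i))) / 2)"
    using mean_product[OF I, of "\<lambda>i c. exp (t * (c * w i))"] by simp
  also have "\<dots> \<le> (\<Prod>i\<in>I. exp (t\<^sup>2))"
  proof (rule prod_mono, rule conjI)
    fix i assume "i \<in> I"
    \<comment> \<open>Only the square of the weight enters the bound for the hyperbolic cosine.\<close>
    then have "(w i)\<^sup>2 = 1" using w[of i] by (metis one_power2 power2_abs)
    then show "(exp (t * w i) + exp (- (t * w i))) / 2 \<le> exp (t\<^sup>2)"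
      using cosh_le_exp_square[of "t * w i"] by (simp add: power_mult_distrib)
  qed (simp add: add_nonneg_nonneg)
  also have "\<dots> = exp (t\<^sup>2 * real (card I))"
    by (simp add: exp_of_nat_mult[symmetric] mult.commute)
  finally show ?thesis .
qed

lemma abs_walsh_eq_1: "x \<in> sign_cube I \<Longrightarrow> S \<subseteq> I \<Longrightarrow> \<bar>walsh S x\<bar> = 1"
  unfolding walsh_def abs_prod by (rule prod.neutral) (use sign_cube_values in force)

text \<open>
  Random signs. With \<open>t = sqrt (N / n)\<close>, where \<open>n\<close> is the number of coefficients, the exponential
  moment of \<open>t * f x\<close> is at most \<open>exp N\<close> at each of the \<open>2 ^ N\<close> points, so for some choice of signs
  the sum of \<open>exp (t * \<bar>f x\<bar>)\<close> over all points is at most exponential in \<open>N\<close>; then \<open>t * \<bar>f x\<bar>\<close> is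
  of the order of \<open>N\<close> at every point.
\<close>

theorem exists_flat_homogeneous:
  fixes I :: "nat set"
  assumes I: "finite I" and m: "m \<le> card I" and N: "card I \<ge> 1"
  obtains a where "\<And>S. S \<subseteq> I \<Longrightarrow> card S = m \<Longrightarrow> \<bar>a S\<bar> = 1"
    and "\<And>S. S \<subseteq> I \<Longrightarrow> card S \<noteq> m \<Longrightarrow> a S = 0"
    and "\<And>x. x \<in> sign_cube I \<Longrightarrow> \<bar>walsh_sum I a x\<bar> \<le> 3 * sqrt (real (card I) * real (card I choose m))"
proof -
  define L where "L = {S \<in> Pow I. card S = m}"
  define N where "N = real (card I)"
  define n where "n = real (card I choose m)"
  define t where "t = sqrt (N / n)"
  have L: "finite L" "real (card L) = n"
    using I by (simp_all add: L_def n_def n_subsets)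
  have n: "n > 0" using m by (simp add: n_def)
  have N1: "N \<ge> 1" using N by (simp add: N_def)
  have t: "t > 0" "t\<^sup>2 * n = N" using n N1 by (simp_all add: t_def)
  define f where "f e x = (\<Sum>S\<in>L. e S * walsh S x)" for e :: "nat set \<Rightarrow> real" and x
  define F where "F e = (\<Sum>x\<in>sign_cube I. exp (t * f e x) + exp (- t * f e x))" for e
  have "mean L F \<le> 2 ^ card I * (2 * exp N)"
  proof -
    have "mean L F = (\<Sum>x\<in>sign_cube I. mean L (\<lambda>e. exp (t * f e x)) + mean L (\<lambda>e. exp (- t * f e x)))"
      unfolding F_def mean_sum mean_add ..
    also have "\<dots> \<le> (\<Sum>x\<in>sign_cube I. exp N + exp N)"
    proof (intro sum_mono add_mono)
      fix x assume x: "x \<in> sign_cube I"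
      have w: "\<bar>walsh S x\<bar> = 1" if "S \<in> L" for S
        using abs_walsh_eq_1[OF x, of S] that by (simp add: L_def)
      show "mean L (\<lambda>e. exp (t * f e x)) \<le> exp N"
        using mean_exp_rademacher_le[where t = t, OF L(1) w] by (simp add: f_def L(2) t(2))
      show "mean L (\<lambda>e. exp (- t * f e x)) \<le> exp N"
        using mean_exp_rademacher_le[where t = "- t", OF L(1) w] by (simp add: f_def L(2) t(2))
    qed
    also have "\<dots> = 2 ^ card I * (2 * exp N)" using I by (simp add: card_sign_cube)
    finally show ?thesis .
  qed
  then obtain e where e: "e \<in> sign_cube L" "F e \<le> 2 ^ card I * (2 * exp N)"
  proof -
    have "\<exists>e\<in>sign_cube L. F e \<le> 2 ^ card I * (2 * exp N)"
    proof (rule ccontr)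
      assume "\<not> ?thesis"
      then have "(\<Sum>e\<in>sign_cube L. 2 ^ card I * (2 * exp N)) < (\<Sum>e\<in>sign_cube L. F e)"
        using L(1) sign_cube_nonempty by (intro sum_strict_mono) (auto simp: not_le)
      then have "2 ^ card I * (2 * exp N) < mean L F"
        using L(1) by (simp add: mean_def card_sign_cube field_simps)
      then show False using \<open>mean L F \<le> _\<close> by simp
    qed
    then show thesis using that by blast
  qed
  define a where "a S = (if S \<in> L then e S else 0)" for S
  have W: "walsh_sum I a x = f e x" for x
    unfolding walsh_sum_def f_def using I
    by (intro sum.mono_neutral_cong_right) (auto simp: a_def L_def)
  show thesis
  proof (rule that[of a])
    fix S assume S: "S \<subseteq> I" "card S = m"
    then have "S \<in> L" by (simp add: L_def)
    then show "\<bar>a S\<bar> = 1" using sign_cube_values[OF e(1), of S] by (auto simp: a_def)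
  next
    fix S assume "S \<subseteq> I" "card S \<noteq> m"
    then show "a S = 0" by (simp add: a_def L_def)
  next
    fix x assume x: "x \<in> sign_cube I"
    have "exp (t * \<bar>f e x\<bar>) \<le> exp (t * f e x) + exp (- t * f e x)"
      by (cases "f e x \<ge> 0") (simp_all add: less_imp_le)
    also have "\<dots> \<le> F e" unfolding F_def
      using x I by (intro member_le_sum[where f = "\<lambda>x. exp (t * f e x) + exp (- t * f e x)"])
        (auto simp: add_nonneg_nonneg)
    also have "\<dots> \<le> 2 ^ card I * (2 * exp N)" by (rule e(2))
    also have "\<dots> \<le> exp 1 ^ card I * (exp 1 * exp N)"
    proof -
      have "(2::real) \<le> exp 1" using exp_ge_add_one_self[of "1::real"] by simp
      then show ?thesis by (intro mult_mono power_mono) auto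
    qed
    also have "exp 1 ^ card I = exp N" by (simp add: N_def flip: exp_of_nat_mult)
    also have "\<dots> * (exp 1 * exp N) = exp (N + 1 + N)" by (simp only: exp_add mult_ac)
    finally have "t * \<bar>f e x\<bar> \<le> N + 1 + N" by simp
    then have "t * \<bar>f e x\<bar> \<le> 3 * N" using N1 by simp
    also have "3 * N = t * (3 * sqrt (N * n))"
    proof -
      have "t * sqrt (N * n) = sqrt (N\<^sup>2)"
        unfolding t_def real_sqrt_mult[symmetric] using n by (simp add: power2_eq_square)
      then show ?thesis using N1 by simp
    qed
    finally have "\<bar>f e x\<bar> \<le> 3 * sqrt (N * n)" using t by simp
    then show "\<bar>walsh_sum I a x\<bar> \<le> 3 * sqrt (real (card I) * real (card I choose m))"
      by (simp add: W N_def n_def)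
  qed
qed

section \<open>The Boolean radius\<close>

lemma cube_eq_sign_cube: "cube N = sign_cube {1..N}"
  by (simp add: cube_def sign_cube_def)

lemma fourier_coeff_eq_mean: "fourier_coeff N f S = mean {1..N} (\<lambda>x. f x * walsh S x)"
  by (simp add: fourier_coeff_def cube_expectation_def mean_def cube_eq_sign_cube)

lemma walsh_sum_fourier_coeff:
  "x \<in> sign_cube {1..N} \<Longrightarrow> walsh_sum {1..N} (fourier_coeff N f) x = f x"
  using walsh_inversion[of "{1..N}" x f] by (simp add: fourier_coeff_eq_mean[abs_def])

lemma fourier_coeff_walsh_sum:
  "S \<subseteq> {1..N} \<Longrightarrow> fourier_coeff N (walsh_sum {1..N} a) S = a S"
  by (simp add: fourier_coeff_eq_mean mean_walsh_sum_mult_walsh)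

lemma abs_le_cube_sup_norm: "x \<in> sign_cube {1..N} \<Longrightarrow> \<bar>f x\<bar> \<le> cube_sup_norm N f"
  unfolding cube_sup_norm_def cube_eq_sign_cube by (intro Max_ge) auto

lemma cube_sup_norm_le:
  "(\<And>x. x \<in> sign_cube {1..N} \<Longrightarrow> \<bar>f x\<bar> \<le> B) \<Longrightarrow> cube_sup_norm N f \<le> B"
  unfolding cube_sup_norm_def cube_eq_sign_cube using sign_cube_nonempty by (intro Max.boundedI) auto

lemma homogeneous_weighted_sum:
  assumes "homogeneous N m f"
  shows "(\<Sum>S\<in>Pow {1..N}. \<bar>fourier_coeff N f S\<bar> * \<rho> ^ card S)
       = \<rho> ^ m * (\<Sum>S\<in>Pow {1..N}. \<bar>fourier_coeff N f S\<bar>)"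
  unfolding sum_distrib_left
proof (rule sum.cong[OF refl])
  fix S assume "S \<in> Pow {1..N}"
  then show "\<bar>fourier_coeff N f S\<bar> * \<rho> ^ card S = \<rho> ^ m * \<bar>fourier_coeff N f S\<bar>"
    using assms by (cases "card S = m") (auto simp: homogeneous_def)
qed

text \<open>
  For a homogeneous function the defining inequality reads \<open>\<rho> ^ m * (\<Sum>S. \<bar>a S\<bar>) \<le> B\<close>, and the
  number on the left is chosen such that its \<open>m\<close>-th power cancels the constant in the bound for the
  sum of the absolute values of the coefficients.
\<close>

lemma boolean_radius_ge:
  fixes m N :: nat
  assumes m: "1 \<le> m" "m \<le> N" and C: "C \<ge> exp 28"
  shows "ereal (1 / (real m powr (1 / (2 * real m)) * C powr sqrt (ln (real m) / real m))
        * real N powr (1 / (2 * real m)) * real (N choose m) powr (- 1 / (2 * real m)))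
       \<le> boolean_radius N (homogeneous_class N m)"
proof -
  define n where "n = real (N choose m)"
  define q where "q = sqrt (real m * ln (real m))"
  define \<rho> where "\<rho> = 1 / (real m powr (1 / (2 * real m)) * C powr sqrt (ln (real m) / real m))
        * real N powr (1 / (2 * real m)) * n powr (- 1 / (2 * real m))"
  have n: "n > 0" using m by (simp add: n_def)
  have C0: "C > 0" using C exp_gt_zero[of "28::real"] by linarith
  have q0: "q \<ge> 0" using m by (simp add: q_def)
  have half: "(z powr (1 / (2 * real m))) ^ m = sqrt z" if "z > 0" for z
    using that m by (simp add: powr_power powr_half_sqrt)
  have "(C powr sqrt (ln (real m) / real m)) ^ m = C powr q"
  proof -
    have "sqrt (ln (real m) / real m) * real m = sqrt (ln (real m) / real m * (real m)\<^sup>2)"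
      unfolding real_sqrt_mult by simp
    also have "\<dots> = q" using m by (simp add: q_def power2_eq_square mult.commute)
    finally show ?thesis using C0 m by (simp add: powr_power mult.commute[of "real m"])
  qed
  moreover have "n powr (- 1 / (2 * real m)) = inverse (n powr (1 / (2 * real m)))"
    by (simp flip: powr_minus)
  ultimately have \<rho>_power: "\<rho> ^ m = 1 / (sqrt (real m) * C powr q) * sqrt (real N) * inverse (sqrt n)"
    using m n unfolding \<rho>_def by (simp only: power_mult_distrib power_divide power_inverse half power_one of_nat_0_less_iff)
  have "(\<Sum>S\<in>Pow {1..N}. \<bar>fourier_coeff N f S\<bar> * \<rho> ^ card S) \<le> cube_sup_norm N f"
    if f: "f \<in> homogeneous_class N m" for f
  proof -
    define B where "B = cube_sup_norm N f"
    define s where "s = sqrt (n / real N)"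
    have hom: "homogeneous N m f" using f by (simp add: homogeneous_class_def)
    have B: "B \<ge> 0"
    proof -
      obtain x where x: "x \<in> sign_cube {1..N}" using sign_cube_nonempty by blast
      show ?thesis using abs_le_cube_sup_norm[OF x, of f] by (simp add: B_def)
    qed
    have s: "s > 0" using n m by (simp add: s_def)
    have "(\<Sum>S\<in>Pow {1..N}. \<bar>fourier_coeff N f S\<bar>) \<le> exp (28 * q) * (s * B)"
    proof -
      have coeff: "fourier_coeff N f S = 0" if "S \<subseteq> {1..N}" "card S \<noteq> m" for S
        using hom that by (simp add: homogeneous_def)
      have sup: "\<bar>walsh_sum {1..N} (fourier_coeff N f) x\<bar> \<le> B" if "x \<in> sign_cube {1..N}" for x
        unfolding walsh_sum_fourier_coeff[OF that] B_def by (rule abs_le_cube_sup_norm[OF that])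
      show ?thesis
        using sum_abs_coeff_le_sup_norm[OF _ coeff m(1) _ sup] m(2)
        by (simp add: n_def q_def s_def)
    qed
    also have "\<dots> \<le> C powr q * (s * B)"
    proof -
      have "exp (28 * q) = exp 28 powr q" by (simp add: powr_def mult.commute)
      also have "\<dots> \<le> C powr q" using C q0 by (intro powr_mono2) auto
      finally show ?thesis using s B by (intro mult_right_mono) auto
    qed
    finally have "\<rho> ^ m * (\<Sum>S\<in>Pow {1..N}. \<bar>fourier_coeff N f S\<bar>) \<le> \<rho> ^ m * (C powr q * (s * B))"
      using C0 n by (intro mult_left_mono) (auto simp: \<rho>_power)
    also have "\<dots> = B / sqrt (real m)"
    proof -
      have "1 / (u * c) * v * inverse w * (c * (w / v * B)) = B / u"
        if "u \<noteq> 0" "v \<noteq> 0" "w \<noteq> 0" "c \<noteq> 0" for u v w c :: real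
        using that by (simp add: field_simps)
      from this[of "sqrt (real m)" "sqrt (real N)" "sqrt n" "C powr q"] show ?thesis
        using C0 n m unfolding \<rho>_power s_def real_sqrt_divide by simp
    qed
    also have "\<dots> \<le> B / 1" using m B by (intro divide_left_mono) auto
    finally show ?thesis unfolding homogeneous_weighted_sum[OF hom] by (simp add: B_def)
  qed
  moreover have "\<rho> \<ge> 0" by (simp add: \<rho>_def)
  ultimately show ?thesis
    unfolding boolean_radius_def \<rho>_def[unfolded n_def, symmetric] by (intro SUP_upper) auto
qed

text \<open>
  Every admissible radius is tested against the function with flat coefficients and small
  maximum.
\<close>

lemma boolean_radius_le:
  fixes m N :: nat
  assumes m: "1 \<le> m" "m \<le> N" and C: "C \<ge> 3"
  shows "boolean_radius N (homogeneous_class N m)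
       \<le> ereal (C powr (1 / real m)
        * real N powr (1 / (2 * real m)) * real (N choose m) powr (- 1 / (2 * real m)))"
  unfolding boolean_radius_def
proof (rule SUP_least, simp only: ereal_less_eq, elim CollectE conjE)
  fix \<rho> :: real
  assume \<rho>: "\<rho> \<ge> 0" and adm: "\<forall>f\<in>homogeneous_class N m.
    (\<Sum>S\<in>Pow {1..N}. \<bar>fourier_coeff N f S\<bar> * \<rho> ^ card S) \<le> cube_sup_norm N f"
  define n where "n = real (N choose m)"
  have n: "n > 0" using m by (simp add: n_def)
  have N: "real N > 0" using m by simp
  obtain a where a: "\<And>S. S \<subseteq> {1..N} \<Longrightarrow> card S = m \<Longrightarrow> \<bar>a S\<bar> = 1"
      "\<And>S. S \<subseteq> {1..N} \<Longrightarrow> card S \<noteq> m \<Longrightarrow> a S = 0"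
    and bound: "\<And>x. x \<in> sign_cube {1..N} \<Longrightarrow> \<bar>walsh_sum {1..N} a x\<bar> \<le> 3 * sqrt (real N * n)"
    using exists_flat_homogeneous[of "{1..N}" m] m by (auto simp: n_def)
  define f where "f = walsh_sum {1..N} a"
  have coeff: "fourier_coeff N f S = a S" if "S \<subseteq> {1..N}" for S
    unfolding f_def using that by (rule fourier_coeff_walsh_sum)
  have hom: "homogeneous N m f" using a coeff by (simp add: homogeneous_def)
  have "(\<Sum>S\<in>Pow {1..N}. \<bar>fourier_coeff N f S\<bar>) = (\<Sum>S\<in>{S \<in> Pow {1..N}. card S = m}. 1)"
    using a coeff by (intro sum.mono_neutral_cong_right) auto
  also have "\<dots> = n" by (simp add: n_def n_subsets)
  finally have "\<rho> ^ m * n \<le> cube_sup_norm N f"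
    using bspec[OF adm, of f] hom homogeneous_weighted_sum[OF hom, of \<rho>]
    by (simp add: homogeneous_class_def)
  also have "\<dots> \<le> 3 * sqrt (real N * n)"
    unfolding f_def by (rule cube_sup_norm_le) (rule bound)
  also have "\<dots> \<le> C * sqrt (real N * n)" using C n by (intro mult_right_mono) auto
  finally have "\<rho> ^ m \<le> C * sqrt (real N * n) / n" using n by (simp add: field_simps)
  also have "\<dots> = C * sqrt (real N) / sqrt n"
  proof -
    have cancel: "C * (v * w) / (w * w) = C * v / w" if "w \<noteq> 0" for v w :: real
      using that by simp
    have "sqrt n * sqrt n = n" using n by simp
    then show ?thesis
      using cancel[of "sqrt n" "sqrt (real N)"] n by (simp only: real_sqrt_mult) simp
  qed
  also have "\<dots> = (C powr (1 / real m) * real N powr (1 / (2 * real m)) * n powr (- 1 / (2 * real m))) ^ m"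
  proof -
    have half: "(z powr (1 / (2 * real m))) ^ m = sqrt z" if "z > 0" for z
      using that m by (simp add: powr_power powr_half_sqrt)
    have root: "(C powr (1 / real m)) ^ m = C" using C m by (simp add: powr_power)
    have inv: "n powr (- 1 / (2 * real m)) = inverse (n powr (1 / (2 * real m)))"
      by (simp flip: powr_minus)
    show ?thesis
      unfolding inv power_mult_distrib power_inverse half[OF N] half[OF n] root
      by (simp only: divide_inverse)
  qed
  finally show "\<rho> \<le> C powr (1 / real m) * real N powr (1 / (2 * real m))
      * real (N choose m) powr (- 1 / (2 * real m))"
    unfolding n_def using m \<rho> by (subst (asm) power_mono_iff) auto
qed

theorem theorem3p1:
  "\<exists>C::real. C > 1 \<and> (\<forall>m N::nat. 1 \<le> m \<and> m \<le> N \<longrightarrow>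
     ereal (1 / (real m powr (1 / (2 * real m)) * C powr sqrt (ln (real m) / real m))
        * real N powr (1 / (2 * real m)) * real (N choose m) powr (- 1 / (2 * real m)))
       \<le> boolean_radius N (homogeneous_class N m) \<and>
     boolean_radius N (homogeneous_class N m)
       \<le> ereal (C powr (1 / real m)
        * real N powr (1 / (2 * real m)) * real (N choose m) powr (- 1 / (2 * real m))))"
proof -
  have "(3::real) \<le> exp 28" using exp_ge_add_one_self[of "28::real"] by linarith
  then show ?thesis
    by (intro exI[of _ "exp 28"] conjI allI impI boolean_radius_ge boolean_radius_le) auto
qed

end
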